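(* Let $|||\cdot|||$ be a normalized symmetric gauge norm on $\mathcal{J}(L^\infty[0,\infty))$. Then there is a subset $\mathcal{F}'$ of $\mathcal{F}$ containing the characteristic function $\chi_{[0,1)}$ such that for all $T\in\mathcal{J}(L^\infty[0,\infty))$, $$|||T|||=\sup\{|||T|||_f:\ f\in\mathcal{F}'\}.$$
   Context: $L^\infty[0,\infty)$ is taken with Lebesgue measure $m$ and tracial weight $\tau=\int_0^\infty\cdot\,dx$. $\mathcal{J}(L^\infty[0,\infty))$ is the set of $T\in L^\infty[0,\infty)$ vanishing a.e. outside some set of finite measure. A symmetric gauge norm on it is a norm with $|||T|||=|||\,|T|\,|||$ and $|||\theta(T)|||=|||T|||$ for every $*$-automorphism $\theta$ of $L^\infty[0,\infty)$ preserving $\tau$ (equivalently $|||T\circ\phi|||=|||T|||$ for every invertible measure preserving map $\phi$ of $[0,\infty)$). It is normalized if $|||\chi_A|||=1$ whenever $m(A)=1$. $\mu_s(T)=\sup(\{0\}\cup\{y\ge 0:\ m(\{|T|>y\})>s\})$, $s\ge0$, is the nonincreasing rearrangement of $|T|$. $\mathcal{F}$ is the set of non-increasing, non-negative, right continuous simple functions $f$ on $[0,\infty)$ with compact support such that $\int_0^1f(x)\,dx\le1$. For $f\in\mathcal{F}$, $|||T|||_f=\int_0^\infty f(s)\mu_s(T)\,ds$. *)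

theory Defs
  imports "HOL-Analysis.Analysis"
begin

text \<open>
  Elements of \<open>L\<^sup>\<infinity>[0,\<infinity>)\<close> are represented by functions \<open>real \<Rightarrow> complex\<close>, identified when they
  agree almost everywhere with respect to \<open>half_line\<close>; values at negative arguments are irrelevant.
\<close>

abbreviation half_line :: "real measure" where
  "half_line \<equiv> lebesgue_on {0..}"

definition ae_eq :: "(real \<Rightarrow> complex) \<Rightarrow> (real \<Rightarrow> complex) \<Rightarrow> bool" (infix "=\<^sub>a" 50) where
  "S =\<^sub>a T \<longleftrightarrow> (AE x in half_line. S x = T x)"

definition Linf :: "(real \<Rightarrow> complex) set" where
  "Linf = {T \<in> borel_measurable half_line. \<exists>C. AE x in half_line. cmod (T x) \<le> C}"

definition J :: "(real \<Rightarrow> complex) set" where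
  "J = {T \<in> Linf. \<exists>A \<in> sets half_line. emeasure half_line A < \<infinity> \<and>
                   (AE x in half_line. x \<notin> A \<longrightarrow> T x = 0)}"

text \<open>The weight \<open>\<tau>\<close> is meant to be applied to positive elements only.\<close>

definition tau :: "(real \<Rightarrow> complex) \<Rightarrow> ennreal" where
  "tau T = (\<integral>\<^sup>+ x. ennreal (Re (T x)) \<partial>half_line)"

text \<open>
  A *-automorphism acts on representatives; all its algebraic properties, including
  well-definedness and bijectivity, are required up to almost everywhere equality.
\<close>

definition star_automorphism :: "((real \<Rightarrow> complex) \<Rightarrow> (real \<Rightarrow> complex)) \<Rightarrow> bool" where
  "star_automorphism \<theta> \<longleftrightarrow>
     (\<forall>T\<in>Linf. \<theta> T \<in> Linf) \<and>
     (\<forall>S\<in>Linf. \<forall>T\<in>Linf. \<theta> S =\<^sub>a \<theta> T \<longleftrightarrow> S =\<^sub>a T) \<and>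
     (\<forall>S\<in>Linf. \<exists>T\<in>Linf. \<theta> T =\<^sub>a S) \<and>
     (\<forall>S\<in>Linf. \<forall>T\<in>Linf. \<theta> (\<lambda>x. S x + T x) =\<^sub>a (\<lambda>x. \<theta> S x + \<theta> T x)) \<and>
     (\<forall>c. \<forall>T\<in>Linf. \<theta> (\<lambda>x. c * T x) =\<^sub>a (\<lambda>x. c * \<theta> T x)) \<and>
     (\<forall>S\<in>Linf. \<forall>T\<in>Linf. \<theta> (\<lambda>x. S x * T x) =\<^sub>a (\<lambda>x. \<theta> S x * \<theta> T x)) \<and>
     (\<forall>T\<in>Linf. \<theta> (\<lambda>x. cnj (T x)) =\<^sub>a (\<lambda>x. cnj (\<theta> T x)))"

definition tau_preserving :: "((real \<Rightarrow> complex) \<Rightarrow> (real \<Rightarrow> complex)) \<Rightarrow> bool" where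
  "tau_preserving \<theta> \<longleftrightarrow>
     (\<forall>T\<in>Linf. (AE x in half_line. T x \<in> \<real>\<^sub>\<ge>\<^sub>0) \<longrightarrow> tau (\<theta> T) = tau T)"

definition norm_on_J :: "((real \<Rightarrow> complex) \<Rightarrow> real) \<Rightarrow> bool" where
  "norm_on_J N \<longleftrightarrow>
     (\<forall>S\<in>J. \<forall>T\<in>J. S =\<^sub>a T \<longrightarrow> N S = N T) \<and>
     (\<forall>T\<in>J. 0 \<le> N T) \<and>
     (\<forall>T\<in>J. N T = 0 \<longleftrightarrow> T =\<^sub>a (\<lambda>x. 0)) \<and>
     (\<forall>c. \<forall>T\<in>J. N (\<lambda>x. c * T x) = cmod c * N T) \<and>
     (\<forall>S\<in>J. \<forall>T\<in>J. N (\<lambda>x. S x + T x) \<le> N S + N T)"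

definition symmetric_gauge_norm :: "((real \<Rightarrow> complex) \<Rightarrow> real) \<Rightarrow> bool" where
  "symmetric_gauge_norm N \<longleftrightarrow>
     norm_on_J N \<and>
     (\<forall>T\<in>J. N (\<lambda>x. complex_of_real (cmod (T x))) = N T) \<and>
     (\<forall>\<theta>. star_automorphism \<theta> \<and> tau_preserving \<theta> \<longrightarrow> (\<forall>T\<in>J. N (\<theta> T) = N T))"

definition normalized :: "((real \<Rightarrow> complex) \<Rightarrow> real) \<Rightarrow> bool" where
  "normalized N \<longleftrightarrow> (\<forall>A\<in>sets half_line. emeasure half_line A = 1 \<longrightarrow> N (indicator A) = 1)"

text \<open>
  For \<open>T \<in> Linf\<close> and \<open>s \<ge> 0\<close> the set below is bounded above, so the real supremum is the
  intended one.
\<close>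

definition mu :: "real \<Rightarrow> (real \<Rightarrow> complex) \<Rightarrow> real" where
  "mu s T = Sup ({0} \<union> {y. 0 \<le> y \<and> emeasure half_line {x \<in> {0..}. y < cmod (T x)} > ennreal s})"

text \<open>
  A function on \<open>[0,\<infinity>)\<close> is represented by its extension by \<open>0\<close> to the negative reals.
\<close>

definition F_class :: "(real \<Rightarrow> real) set" where
  "F_class = {f. (\<forall>x<0. f x = 0) \<and>
                 antimono_on {0..} f \<and>
                 (\<forall>x\<ge>0. 0 \<le> f x) \<and>
                 (\<forall>x\<ge>0. continuous (at_right x) f) \<and>
                 simple_function half_line f \<and>
                 compact (closure {x. f x \<noteq> 0}) \<and>
                 (LINT x:{0..1}|lebesgue. f x) \<le> 1}"

definition f_norm :: "(real \<Rightarrow> real) \<Rightarrow> (real \<Rightarrow> complex) \<Rightarrow> real" where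
  "f_norm f T = (LINT s:{0..}|lebesgue. f s * mu s T)"

end

(*
  Two elements of J with equidistributed absolute values have the same norm: on simple functions this
  is invariance under automorphisms, because the map sending a point to its rank in a suitable order
  is a measure preserving isomorphism onto [0, infinity) that carries given nested sets to intervals;
  the general case follows by approximation with monotonicity. So |||T||| = |||mu(T)|||, and it is
  enough to consider nonincreasing functions. On these, averaging over an interval does not increase
  the norm, since the average is nearly a mean of equidistributed cyclic rearrangements.
  Given T, approximate mu(T) by a step function and take a supporting functional at it on the finite
  dimensional space of step functions with the same breakpoints (finite dimensional Hahn-Banach).
  Composed with the averaging projection it is integration against a step function f that is bounded by
  the norm on all nonincreasing functions. Replacing f by its mean on two adjacent intervals on
  which it increases keeps this bound and does not decrease its value at mu(T); after finitely many such
  steps f is nonincreasing. Then F' consists of all f in F with |||T|||_f <= |||T||| for every T.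
*)
theory Submission
  imports Defs
begin

section \<open>The ideal and its norm\<close>

text \<open>Equidistributed functions need not be related by an automorphism: the modulus of one may
  be injective on its support and that of the other two-to-one. Invariance is therefore usable only
  on finitely many nested level sets, and everything else is approximation by layers. The dual bound
  is tested on nonincreasing functions only. This is enough because \<open>f_norm f T\<close> pairs
  \<open>f\<close> with a rearrangement, and it is the right class because it is stable under
  averaging over an interval. Averaging is self-adjoint for the pairing, so a mean taken of
  \<open>f\<close> can be moved to the test function, where it does not raise the norm; this is why
  pooling \<open>f\<close> respects the bound. The functional is obtained for the norm of the
  positive part of a step function rather than for the norm itself, which makes its coefficients
  nonnegative. Normalization enters through one test function, the indicator of
  \<open>{0..<1}\<close>: it bounds the integral of each \<open>f\<close> over the unit interval,
  and together with averaging over that interval it puts the indicator itself into the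
  family.\<close>

lemma J_measurable: "T \<in> J \<Longrightarrow> T \<in> borel_measurable half_line"
  by (simp add: J_def Linf_def)

lemma J_subset_Linf: "T \<in> J \<Longrightarrow> T \<in> Linf"
  by (simp add: J_def)

text \<open>Reduces membership in \<open>J\<close> of functions derived from \<open>T\<close> to
  measurability and a pointwise bound: a set that carries \<open>T\<close> also carries
  \<open>S\<close>.\<close>

lemma J_dominated:
  assumes T: "T \<in> J" and S: "S \<in> borel_measurable half_line"
    and le: "AE x in half_line. cmod (S x) \<le> c * cmod (T x)"
  shows "S \<in> J"
proof -
  from T obtain C A where C: "AE x in half_line. cmod (T x) \<le> C"
    and A: "A \<in> sets half_line" "emeasure half_line A < \<infinity>" "AE x in half_line. x \<notin> A \<longrightarrow> T x = 0"
    unfolding J_def Linf_def by blast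
  have "AE x in half_line. cmod (S x) \<le> \<bar>c\<bar> * C"
    using C le
  proof eventually_elim
    case (elim x)
    have "c * cmod (T x) \<le> \<bar>c\<bar> * C"
      using elim by (intro mult_mono) auto
    with elim show ?case by linarith
  qed
  moreover have "AE x in half_line. x \<notin> A \<longrightarrow> S x = 0"
    using A(3) le by eventually_elim auto
  ultimately show ?thesis
    using S A unfolding J_def Linf_def by blast
qed

lemma J_cong_AE:
  assumes "T \<in> J" "S \<in> borel_measurable half_line" "S =\<^sub>a T"
  shows "S \<in> J"
  by (rule J_dominated[OF assms(1,2), where c = 1]) (use assms(3) in \<open>auto simp: ae_eq_def\<close>)

lemma J_add:
  assumes "S \<in> J" "T \<in> J"
  shows "(\<lambda>x. S x + T x) \<in> J"
proof -
  from assms obtain C A D B where C: "AE x in half_line. cmod (S x) \<le> C"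
    and A: "A \<in> sets half_line" "emeasure half_line A < \<infinity>" "AE x in half_line. x \<notin> A \<longrightarrow> S x = 0"
    and D: "AE x in half_line. cmod (T x) \<le> D"
    and B: "B \<in> sets half_line" "emeasure half_line B < \<infinity>" "AE x in half_line. x \<notin> B \<longrightarrow> T x = 0"
    unfolding J_def Linf_def by blast
  have [measurable]: "S \<in> borel_measurable half_line" "T \<in> borel_measurable half_line"
    using assms by (auto dest: J_measurable)
  have "AE x in half_line. cmod (S x + T x) \<le> C + D"
    using C D by eventually_elim (rule order_trans[OF norm_triangle_ineq], simp)
  moreover have "AE x in half_line. x \<notin> A \<union> B \<longrightarrow> S x + T x = 0"
    using A(3) B(3) by eventually_elim auto
  moreover have "emeasure half_line (A \<union> B) < \<infinity>"
    using emeasure_subadditive[OF A(1) B(1)] A(2) B(2)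
    by (metis ennreal_add_less_top infinity_ennreal_def le_less_trans)
  ultimately show ?thesis
    using A(1) B(1) unfolding J_def Linf_def by (intro CollectI conjI bexI[of _ "A \<union> B"]) auto
qed

lemma J_scale:
  assumes "T \<in> J" shows "(\<lambda>x. c * T x) \<in> J"
proof (rule J_dominated[OF assms, where c = "cmod c"])
  show "(\<lambda>x. c * T x) \<in> borel_measurable half_line"
    using J_measurable[OF assms] by measurable
qed (simp add: norm_mult)

lemma J_indicator:
  assumes "A \<in> sets half_line" "emeasure half_line A < \<infinity>"
  shows "(\<lambda>x. of_real (indicator A x)) \<in> J"
proof -
  have "AE x in half_line. cmod (of_real (indicator A x)) \<le> 1"
    by (auto simp: indicator_def)
  then show ?thesis
    using assms unfolding J_def Linf_def
    by (intro CollectI conjI exI bexI[of _ A]) auto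
qed

lemma J_zero: "(\<lambda>x. 0) \<in> J"
  using J_indicator[of "{}"] by simp

lemma J_sum:
  assumes "finite I" "\<And>i. i \<in> I \<Longrightarrow> T i \<in> J"
  shows "(\<lambda>x. \<Sum>i\<in>I. T i x) \<in> J"
  using assms by (induction I rule: finite_induct) (auto intro: J_zero J_add)

locale symmetric_gauge =
  fixes N :: "(real \<Rightarrow> complex) \<Rightarrow> real"
  assumes gauge: "symmetric_gauge_norm N"
begin

lemma N_cong: "S \<in> J \<Longrightarrow> T \<in> J \<Longrightarrow> S =\<^sub>a T \<Longrightarrow> N S = N T"
  using gauge unfolding symmetric_gauge_norm_def norm_on_J_def by blast

lemma N_nonneg: "T \<in> J \<Longrightarrow> 0 \<le> N T"
  using gauge unfolding symmetric_gauge_norm_def norm_on_J_def by blast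

lemma N_scale: "T \<in> J \<Longrightarrow> N (\<lambda>x. c * T x) = cmod c * N T"
  using gauge unfolding symmetric_gauge_norm_def norm_on_J_def by blast

lemma N_triangle: "S \<in> J \<Longrightarrow> T \<in> J \<Longrightarrow> N (\<lambda>x. S x + T x) \<le> N S + N T"
  using gauge unfolding symmetric_gauge_norm_def norm_on_J_def by blast

lemma N_abs: "T \<in> J \<Longrightarrow> N (\<lambda>x. complex_of_real (cmod (T x))) = N T"
  using gauge unfolding symmetric_gauge_norm_def by blast

lemma N_automorphism: "star_automorphism \<theta> \<Longrightarrow> tau_preserving \<theta> \<Longrightarrow> T \<in> J \<Longrightarrow> N (\<theta> T) = N T"
  using gauge unfolding symmetric_gauge_norm_def by blast

lemma N_zero: "N (\<lambda>x. 0) = 0"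
  using N_scale[OF J_zero, of 0] by simp

lemma N_sum:
  assumes "finite I" "\<And>i. i \<in> I \<Longrightarrow> T i \<in> J"
  shows "N (\<lambda>x. \<Sum>i\<in>I. T i x) \<le> (\<Sum>i\<in>I. N (T i))"
  using assms
proof (induction I rule: finite_induct)
  case (insert i I)
  then show ?case
    using N_triangle[of "T i" "\<lambda>x. \<Sum>i\<in>I. T i x"] by (auto simp: J_sum)
qed (simp add: N_zero)

text \<open>A contraction \<open>0 \<le> g \<le> 1\<close> is the mean of the unimodular functions \<open>g \<plusminus> i\<surd>(1 - g\<^sup>2)\<close>.\<close>

lemma N_mono:
  assumes S: "S \<in> J" and T: "T \<in> J" and le: "AE x in half_line. cmod (S x) \<le> cmod (T x)"
  shows "N S \<le> N T"
proof -
  have [measurable]: "S \<in> borel_measurable half_line" "T \<in> borel_measurable half_line"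
    using S T by (auto dest: J_measurable)
  \<comment> \<open>The minimum keeps \<open>g\<close> below 1 at every point, although the
    hypothesis holds only almost everywhere. Where \<open>T x = 0\<close> the quotient is
    \<open>0\<close> by convention, and \<open>S x\<close> vanishes there almost everywhere.\<close>
  define g where "g x = min 1 (cmod (S x) / cmod (T x))" for x
  have g: "0 \<le> g x" "g x \<le> 1" for x by (auto simp: g_def)
  have [measurable]: "g \<in> borel_measurable half_line" unfolding g_def by measurable
  define u where "u \<epsilon> x = Complex (g x) (\<epsilon> * sqrt (1 - (g x)\<^sup>2))" for \<epsilon> x
  have u: "cmod (u \<epsilon> x) = 1" if "\<bar>\<epsilon>\<bar> = 1" for \<epsilon> x
  proof -
    have "\<epsilon>\<^sup>2 = 1" using that by (simp add: power2_eq_1_iff abs_if split: if_splits)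
    moreover have "(g x)\<^sup>2 \<le> 1" using g[of x] by (simp add: power_le_one)
    ultimately show ?thesis
      unfolding u_def by (simp add: complex_norm power_mult_distrib)
  qed
  have [measurable]: "u \<epsilon> \<in> borel_measurable half_line" for \<epsilon>
    unfolding u_def Complex_eq by measurable
  define V where "V \<epsilon> x = of_real (cmod (T x)) * u \<epsilon> x" for \<epsilon> x
  have V_meas [measurable]: "V \<epsilon> \<in> borel_measurable half_line" for \<epsilon>
    unfolding V_def by measurable
  have V_norm: "cmod (V \<epsilon> x) = cmod (T x)" if "\<bar>\<epsilon>\<bar> = 1" for \<epsilon> x
    using u[OF that] by (simp add: V_def norm_mult)
  have V: "V \<epsilon> \<in> J" if "\<bar>\<epsilon>\<bar> = 1" for \<epsilon>
    by (rule J_dominated[OF T V_meas, where c = 1]) (simp add: V_norm[OF that])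
  have NV: "N (V \<epsilon>) = N T" if "\<bar>\<epsilon>\<bar> = 1" for \<epsilon>
    using N_abs[OF V[OF that]] N_abs[OF T] by (simp add: V_norm[OF that])
  have V2: "(\<lambda>x. (1/2) * V \<epsilon> x) \<in> J" if "\<bar>\<epsilon>\<bar> = 1" for \<epsilon>
    by (rule J_scale[OF V[OF that]])
  have absS: "(\<lambda>x. complex_of_real (cmod (S x))) \<in> J"
    by (rule J_dominated[OF S, where c = 1]) auto
  have "(\<lambda>x. complex_of_real (cmod (S x))) =\<^sub>a (\<lambda>x. (1/2) * V 1 x + (1/2) * V (-1) x)"
    unfolding ae_eq_def using le
  proof eventually_elim
    case (elim x)
    have "cmod (T x) * g x = cmod (S x)"
      using elim by (cases "T x = 0") (auto simp: g_def min_def divide_simps)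
    then show ?case
      by (simp add: V_def u_def complex_eq_iff)
  qed
  then have "N S = N (\<lambda>x. (1/2) * V 1 x + (1/2) * V (-1) x)"
    using N_cong[OF absS J_add[OF V2 V2]] N_abs[OF S] by simp
  also have "\<dots> \<le> N (\<lambda>x. (1/2) * V 1 x) + N (\<lambda>x. (1/2) * V (-1) x)"
    by (rule N_triangle[OF V2 V2]) simp_all
  also have "\<dots> = N T"
    using N_scale[OF V, of 1 "1/2"] N_scale[OF V, of "-1" "1/2"] NV[of 1] NV[of "-1"] by simp
  finally show ?thesis .
qed

end

section \<open>A finite dimensional Hahn-Banach theorem\<close>

definition sublinear :: "(('a \<Rightarrow> real) \<Rightarrow> real) \<Rightarrow> bool" where
  "sublinear p \<longleftrightarrow> (\<forall>x y. p (\<lambda>i. x i + y i) \<le> p x + p y) \<and> (\<forall>t\<ge>0. \<forall>x. p (\<lambda>i. t * x i) = t * p x)"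

lemma sublinear_add: "sublinear p \<Longrightarrow> p (\<lambda>i. x i + y i) \<le> p x + p y"
  and sublinear_scale: "sublinear p \<Longrightarrow> 0 \<le> t \<Longrightarrow> p (\<lambda>i. t * x i) = t * p x"
  unfolding sublinear_def by blast+

lemma sublinear_zero: "sublinear p \<Longrightarrow> p (\<lambda>i. 0) = 0"
  using sublinear_scale[of p 0 "\<lambda>_. 0"] by simp

lemma sublinear_neg: "sublinear p \<Longrightarrow> - p (\<lambda>i. - x i) \<le> p x"
  using sublinear_add[of p x "\<lambda>i. - x i"] sublinear_zero[of p] by simp

lemma sublinear_sum:
  assumes "sublinear p" "finite I"
  shows "p (\<lambda>i. \<Sum>j\<in>I. v j i) \<le> (\<Sum>j\<in>I. p (v j))"
  using assms(2)
proof (induction I rule: finite_induct)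
  case (insert j I)
  then show ?case
    using sublinear_add[OF assms(1), of "v j" "\<lambda>i. \<Sum>j\<in>I. v j i"] by simp
qed (simp add: sublinear_zero[OF assms(1)])

text \<open>One step of the Hahn-Banach argument: take for \<open>q x\<close> the infimum over t
  \<ge> 0 of \<open>p (x + t v) - t * p v\<close>. Since 0 \<le> \<open>q v + q (- v)\<close> for
  sublinear \<open>q\<close>, the two bounds force \<open>q v = p v\<close> and
  \<open>q (- v) = - p v\<close>, so \<open>q\<close> is linear along \<open>v\<close> and has not
  dropped there.\<close>

lemma sublinear_linearise:
  assumes p: "sublinear p"
  obtains q where "sublinear q" "\<And>x. q x \<le> p x" "q (\<lambda>i. - v i) \<le> - p v"
proof -
  define Q where "Q x = (\<lambda>t. p (\<lambda>i. x i + t * v i) - t * p v) ` {0..}" for x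
  define q where "q x = Inf (Q x)" for x
  \<comment> \<open>A lower bound independent of \<open>t\<close>, so the infimum is finite.\<close>
  have lower: "- p (\<lambda>i. - x i) \<le> p (\<lambda>i. x i + t * v i) - t * p v" if "0 \<le> t" for x t
    using sublinear_add[OF p, of "\<lambda>i. x i + t * v i" "\<lambda>i. - x i"] sublinear_scale[OF p that, of v]
    by simp
  have bdd: "bdd_below (Q x)" for x
    unfolding Q_def using lower[of _ x] by (intro bdd_belowI[of _ "- p (\<lambda>i. - x i)"]) auto
  have ne: "Q x \<noteq> {}" for x by (simp add: Q_def)
  have upper: "q x \<le> p (\<lambda>i. x i + t * v i) - t * p v" if "0 \<le> t" for x t
    unfolding q_def by (rule cInf_lower[OF _ bdd]) (use that in \<open>auto simp: Q_def\<close>)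
  have greatest: "c \<le> q x" if "\<And>t. 0 \<le> t \<Longrightarrow> c \<le> p (\<lambda>i. x i + t * v i) - t * p v" for c x
    unfolding q_def by (rule cInf_greatest[OF ne]) (use that in \<open>auto simp: Q_def\<close>)
  have add: "q (\<lambda>i. x i + y i) \<le> q x + q y" for x y
  proof -
    have "q (\<lambda>i. x i + y i) - (p (\<lambda>i. x i + t * v i) - t * p v) \<le> q y" if t: "0 \<le> t" for t
    proof (rule greatest)
      fix s :: real assume s: "0 \<le> s"
      have "q (\<lambda>i. x i + y i) \<le> p (\<lambda>i. x i + y i + (t + s) * v i) - (t + s) * p v"
        by (rule upper) (use s t in auto)
      also have "(\<lambda>i. x i + y i + (t + s) * v i) = (\<lambda>i. (x i + t * v i) + (y i + s * v i))"
        by (auto simp: algebra_simps)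
      also have "p \<dots> \<le> p (\<lambda>i. x i + t * v i) + p (\<lambda>i. y i + s * v i)"
        by (rule sublinear_add[OF p])
      finally show "q (\<lambda>i. x i + y i) - (p (\<lambda>i. x i + t * v i) - t * p v)
          \<le> p (\<lambda>i. y i + s * v i) - s * p v"
        by (simp add: algebra_simps)
    qed
    then have "q (\<lambda>i. x i + y i) - q y \<le> q x"
      by (intro greatest) (simp add: algebra_simps)
    then show ?thesis by simp
  qed
  have scale_le: "q (\<lambda>i. t * x i) \<le> t * q x" if t: "0 < t" for t x
  proof -
    have "q (\<lambda>i. t * x i) / t \<le> q x"
    proof (rule greatest)
      fix s :: real assume s: "0 \<le> s"
      have "q (\<lambda>i. t * x i) \<le> p (\<lambda>i. t * x i + (t * s) * v i) - (t * s) * p v"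
        by (rule upper) (use s t in auto)
      also have "(\<lambda>i. t * x i + (t * s) * v i) = (\<lambda>i. t * (x i + s * v i))"
        by (auto simp: algebra_simps)
      also have "p \<dots> = t * p (\<lambda>i. x i + s * v i)"
        using t by (intro sublinear_scale[OF p]) auto
      finally show "q (\<lambda>i. t * x i) / t \<le> p (\<lambda>i. x i + s * v i) - s * p v"
        using t by (simp add: divide_simps algebra_simps)
    qed
    then show ?thesis using t by (simp add: divide_simps mult.commute)
  qed
  have scale: "q (\<lambda>i. t * x i) = t * q x" if t: "0 \<le> t" for t x
  proof (cases "t = 0")
    case True
    have "q (\<lambda>i. 0) = 0"
    proof (rule antisym)
      show "q (\<lambda>i. 0) \<le> 0" using upper[of 0 "\<lambda>_. 0"] by (simp add: sublinear_zero[OF p])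
      show "0 \<le> q (\<lambda>i. 0)" by (rule greatest) (simp add: sublinear_scale[OF p])
    qed
    with True show ?thesis by simp
  next
    case False
    with t have t: "0 < t" by simp
    have "q (\<lambda>i. (1/t) * (t * x i)) \<le> (1/t) * q (\<lambda>i. t * x i)"
      by (rule scale_le) (use t in auto)
    then have "t * q x \<le> q (\<lambda>i. t * x i)"
      using t by (simp add: divide_simps mult.commute)
    with scale_le[OF t, of x] show ?thesis by simp
  qed
  show thesis
  proof
    show "sublinear q" using add scale by (simp add: sublinear_def)
    show "q x \<le> p x" for x using upper[of 0 x] by simp
    show "q (\<lambda>i. - v i) \<le> - p v"
      using upper[of 1 "\<lambda>i. - v i"] by (simp add: sublinear_zero[OF p])
  qed
qed

text \<open>Linearise first along \<open>a\<close>, which preserves the value \<open>p a\<close>,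
  then along each of the \<open>k\<close> unit vectors. Later steps only lower the function, and
  this does not destroy what was gained: from \<open>r \<le> q\<close> and
  \<open>q (- e) \<le> - q e\<close> follows \<open>r (- e) \<le> - r e\<close>. In the end the
  values at the unit vectors are the coefficients.\<close>

lemma sublinear_supporting_functional:
  fixes p :: "(nat \<Rightarrow> real) \<Rightarrow> real"
  assumes p: "sublinear p" and a: "\<And>i. i \<ge> k \<Longrightarrow> a i = 0"
  obtains c where "\<And>x. (\<And>i. i \<ge> k \<Longrightarrow> x i = 0) \<Longrightarrow> (\<Sum>i<k. c i * x i) \<le> p x"
    "p a \<le> (\<Sum>i<k. c i * a i)"
proof -
  define e :: "nat \<Rightarrow> nat \<Rightarrow> real" where "e j i = (if i = j then 1 else 0)" for i j
  have "\<exists>q. sublinear q \<and> (\<forall>x. q x \<le> p x) \<and> q (\<lambda>i. - a i) \<le> - p a \<and>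
      (\<forall>j<n. q (\<lambda>i. - e j i) \<le> - q (e j))" for n
  proof (induction n)
    case 0
    show ?case using sublinear_linearise[OF p, of a] by (metis not_less_zero)
  next
    case (Suc n)
    then obtain q where q: "sublinear q" "\<And>x. q x \<le> p x" "q (\<lambda>i. - a i) \<le> - p a"
      "\<And>j. j < n \<Longrightarrow> q (\<lambda>i. - e j i) \<le> - q (e j)"
      by blast
    obtain r where r: "sublinear r" "\<And>x. r x \<le> q x" "r (\<lambda>i. - e n i) \<le> - q (e n)"
      using sublinear_linearise[OF q(1), where v = "e n"] by blast
    have "r (\<lambda>i. - e j i) \<le> - r (e j)" if "j < Suc n" for j
    proof (cases "j = n")
      case True
      then show ?thesis using r(2)[of "e n"] r(3) by simp
    next
      case False
      then have "q (\<lambda>i. - e j i) \<le> - q (e j)" using q(4) that by simp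
      then show ?thesis using r(2)[of "\<lambda>i. - e j i"] r(2)[of "e j"] by linarith
    qed
    moreover have "r (\<lambda>i. - a i) \<le> - p a" using q(3) r(2) order_trans by blast
    moreover have "r x \<le> p x" for x using q(2) r(2) order_trans by blast
    ultimately show ?case using r(1) by blast
  qed
  then obtain q where q: "sublinear q" "\<And>x. q x \<le> p x" "q (\<lambda>i. - a i) \<le> - p a"
      "\<And>j. j < k \<Longrightarrow> q (\<lambda>i. - e j i) \<le> - q (e j)"
    by blast
  have lin: "q (\<lambda>i. t * e j i) \<le> t * q (e j)" if "j < k" for t j
  proof (cases "0 \<le> t")
    case True
    then show ?thesis by (simp add: sublinear_scale[OF q(1)])
  next
    case False
    then have "q (\<lambda>i. (-t) * (- e j i)) = (-t) * q (\<lambda>i. - e j i)"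
      by (intro sublinear_scale[OF q(1)]) auto
    also have "\<dots> \<le> (-t) * (- q (e j))"
      using False q(4)[OF that] by (intro mult_left_mono) auto
    finally show ?thesis by simp
  qed
  have le: "q x \<le> (\<Sum>j<k. q (e j) * x j)" if x: "\<And>i. i \<ge> k \<Longrightarrow> x i = 0" for x
  proof -
    have "x = (\<lambda>i. \<Sum>j<k. x j * e j i)"
    proof
      fix i
      have "(\<Sum>j<k. x j * e j i) = (\<Sum>j\<in>{..<k}. if j = i then x j else 0)"
        by (rule sum.cong) (auto simp: e_def)
      then show "x i = (\<Sum>j<k. x j * e j i)" using x[of i] by auto
    qed
    then have "q x = q (\<lambda>i. \<Sum>j<k. x j * e j i)" by simp
    also have "\<dots> \<le> (\<Sum>j<k. q (\<lambda>i. x j * e j i))" by (rule sublinear_sum[OF q(1)]) simp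
    also have "\<dots> \<le> (\<Sum>j<k. q (e j) * x j)"
      by (rule sum_mono) (use lin in \<open>simp add: mult.commute\<close>)
    finally show ?thesis .
  qed
  show thesis
  proof
    fix x :: "nat \<Rightarrow> real" assume x: "\<And>i. i \<ge> k \<Longrightarrow> x i = 0"
    \<comment> \<open>\<open>le\<close> bounds \<open>q\<close> from above only; used at
      \<open>- x\<close> it gives the bound from below.\<close>
    have "- q x \<le> q (\<lambda>i. - x i)" using sublinear_neg[OF q(1), of x] by simp
    also have "\<dots> \<le> - (\<Sum>j<k. q (e j) * x j)"
      using le[of "\<lambda>i. - x i"] x by (simp add: sum_negf)
    finally show "(\<Sum>i<k. q (e i) * x i) \<le> p x" using q(2)[of x] by linarith
  next
    have "p a \<le> - q (\<lambda>i. - a i)" using q(3) by simp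
    also have "\<dots> \<le> q a" using sublinear_neg[OF q(1), of a] by linarith
    also have "\<dots> \<le> (\<Sum>j<k. q (e j) * a j)" by (rule le[OF a])
    finally show "p a \<le> (\<Sum>i<k. q (e i) * a i)" .
  qed
qed

section \<open>Measure preserving maps\<close>

lemma AE_half_line_iff: "(AE x in half_line. P x) \<longleftrightarrow> (AE x in lebesgue. 0 \<le> x \<longrightarrow> P x)"
  by (subst AE_restrict_space_iff) auto

lemma borel_measurable_half_lineI: "f \<in> borel_measurable borel \<Longrightarrow> f \<in> borel_measurable half_line"
  by (intro measurable_restrict_space1 measurable_completion) simp

text \<open>Needed for composition with a Borel inverse: a Lebesgue measurable function composed
  with a Borel one may fail to be measurable. The bound holds at every point and so survives any
  composition.\<close>

lemma Linf_borel_representative: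
  assumes "S \<in> Linf"
  obtains S' :: "real \<Rightarrow> complex" and C
  where "S' \<in> borel_measurable borel" "\<And>x. cmod (S' x) \<le> C" "AE x in half_line. S' x = S x"
proof -
  from assms obtain C where S: "S \<in> borel_measurable half_line"
    and C: "AE x in half_line. cmod (S x) \<le> C"
    unfolding Linf_def by blast
  have "(\<lambda>x. if x \<in> {0..} then S x else 0) \<in> borel_measurable lebesgue"
    by (rule borel_measurable_if_I[OF S]) simp
  then have "(\<lambda>x. Re (if x \<in> {0..} then S x else 0)) \<in> borel_measurable lebesgue"
    "(\<lambda>x. Im (if x \<in> {0..} then S x else 0)) \<in> borel_measurable lebesgue"
    by measurable
  from this[THEN completion_ex_borel_measurable_real] obtain r i
    where ri [measurable]: "r \<in> borel_measurable borel" "i \<in> borel_measurable borel"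
    and r: "AE x in lborel. Re (if x \<in> {0..} then S x else 0) = r x"
    and i: "AE x in lborel. Im (if x \<in> {0..} then S x else 0) = i x"
    by auto
  \<comment> \<open>Cut off to \<open>0\<close> where the essential bound fails, which changes
    nothing almost everywhere.\<close>
  define S' where "S' x = (if cmod (Complex (r x) (i x)) \<le> C then Complex (r x) (i x) else 0)" for x
  have "AE x in lebesgue. 0 \<le> x \<longrightarrow> S x = Complex (r x) (i x)"
    using AE_completion[OF r] AE_completion[OF i] by eventually_elim (auto simp: complex_eq_iff)
  then have "AE x in half_line. S x = Complex (r x) (i x)"
    by (simp add: AE_half_line_iff)
  then have "AE x in half_line. S' x = S x"
    using C by eventually_elim (auto simp: S'_def)
  moreover have "S' \<in> borel_measurable borel"
    unfolding S'_def Complex_eq by measurable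
  moreover have "cmod (S' x) \<le> max C 0" for x
    by (auto simp: S'_def)
  ultimately show thesis by (rule that[rotated 2])
qed

text \<open>Invertibility is encoded by an almost everywhere left inverse. It makes composition with
  \<phi> surjective on classes, since \<open>S\<close> comes from the composition of a Borel
  representative with \<open>g\<close>; injectivity on classes comes from the image measure.\<close>

definition mp_map :: "(real \<Rightarrow> real) \<Rightarrow> bool" where
  "mp_map \<phi> \<longleftrightarrow> \<phi> \<in> half_line \<rightarrow>\<^sub>M half_line \<and> distr half_line half_line \<phi> = half_line \<and>
     (\<exists>g\<in>borel_measurable borel. AE x in half_line. g (\<phi> x) = x)"

lemma mp_map_AE:
  assumes "mp_map \<phi>" "AE x in half_line. P x"
  shows "AE x in half_line. P (\<phi> x)"
proof (rule AE_distrD[where M' = half_line])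
  show "\<phi> \<in> half_line \<rightarrow>\<^sub>M half_line" using assms(1) by (simp add: mp_map_def)
  have "distr half_line half_line \<phi> = half_line" using assms(1) by (simp add: mp_map_def)
  then show "AE x in distr half_line half_line \<phi>. P x" using assms(2) by (simp only:)
qed

lemma mp_map_Linf:
  assumes "mp_map \<phi>" "T \<in> Linf"
  shows "(\<lambda>x. T (\<phi> x)) \<in> Linf"
proof -
  from assms obtain C where "AE x in half_line. cmod (T x) \<le> C" by (auto simp: Linf_def)
  then have "AE x in half_line. cmod (T (\<phi> x)) \<le> C" by (rule mp_map_AE[OF assms(1)])
  moreover have "\<phi> \<in> half_line \<rightarrow>\<^sub>M half_line" "T \<in> borel_measurable half_line"
    using assms by (auto simp: mp_map_def Linf_def)
  then have "(\<lambda>x. T (\<phi> x)) \<in> borel_measurable half_line"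
    by (rule measurable_compose)
  ultimately show ?thesis by (auto simp: Linf_def)
qed

lemma mp_map_star_automorphism:
  assumes \<phi>: "mp_map \<phi>"
  shows "star_automorphism (\<lambda>T x. T (\<phi> x))"
proof -
  have meas: "\<phi> \<in> half_line \<rightarrow>\<^sub>M half_line" and distr: "distr half_line half_line \<phi> = half_line"
    using \<phi> by (auto simp: mp_map_def)
  obtain g where g [measurable]: "g \<in> borel_measurable borel" and inv: "AE x in half_line. g (\<phi> x) = x"
    using \<phi> by (auto simp: mp_map_def)
  have "(\<lambda>x. S (\<phi> x)) =\<^sub>a (\<lambda>x. T (\<phi> x)) \<longleftrightarrow> S =\<^sub>a T" if "S \<in> Linf" "T \<in> Linf" for S T
  proof -
    have [measurable]: "S \<in> borel_measurable half_line" "T \<in> borel_measurable half_line"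
      using that by (auto simp: Linf_def)
    have "{x \<in> space half_line. S x = T x} \<in> sets half_line"
      by measurable
    from AE_distr_iff[OF meas this] show ?thesis
      unfolding distr ae_eq_def by (rule sym)
  qed
  moreover have "\<exists>T\<in>Linf. (\<lambda>x. T (\<phi> x)) =\<^sub>a S" if S: "S \<in> Linf" for S
  proof -
    obtain S' C where S': "S' \<in> borel_measurable borel" "\<And>x. cmod (S' x) \<le> C"
      "AE x in half_line. S' x = S x"
      by (rule Linf_borel_representative[OF S]) blast
    have "(\<lambda>y. S' (g y)) \<in> borel_measurable half_line"
      by (rule borel_measurable_half_lineI[OF measurable_compose[OF g S'(1)]])
    then have "(\<lambda>y. S' (g y)) \<in> Linf" using S'(2) by (auto simp: Linf_def)
    moreover have "(\<lambda>x. S' (g (\<phi> x))) =\<^sub>a S"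
      unfolding ae_eq_def using inv S'(3) by eventually_elim simp
    ultimately show ?thesis by (intro bexI[of _ "\<lambda>y. S' (g y)"])
  qed
  ultimately show ?thesis
    unfolding star_automorphism_def by (simp add: mp_map_Linf[OF \<phi>]) (simp add: ae_eq_def)
qed

lemma mp_map_tau_preserving:
  assumes "mp_map \<phi>"
  shows "tau_preserving (\<lambda>T x. T (\<phi> x))"
  unfolding tau_preserving_def
proof (intro ballI impI)
  fix T assume "T \<in> Linf"
  then have [measurable]: "T \<in> borel_measurable half_line" by (simp add: Linf_def)
  have "tau T = (\<integral>\<^sup>+ x. ennreal (Re (T x)) \<partial>distr half_line half_line \<phi>)"
    using assms by (simp add: tau_def mp_map_def)
  also have "\<dots> = tau (\<lambda>x. T (\<phi> x))"
    unfolding tau_def using assms by (subst nn_integral_distr) (auto simp: mp_map_def)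
  finally show "tau (\<lambda>x. T (\<phi> x)) = tau T" by simp
qed

lemma (in symmetric_gauge) N_mp_map: "mp_map \<phi> \<Longrightarrow> T \<in> J \<Longrightarrow> N (\<lambda>x. T (\<phi> x)) = N T"
  using N_automorphism[OF mp_map_star_automorphism mp_map_tau_preserving] by simp

section \<open>Recognising measure preserving maps by their distribution function\<close>

lemma half_line_emeasure:
  "A \<subseteq> {0..} \<Longrightarrow> emeasure half_line A = emeasure lebesgue A"
  by (rule emeasure_restrict_space) auto

lemma emeasure_half_line_Ico: "0 \<le> p \<Longrightarrow> p \<le> q \<Longrightarrow> emeasure half_line {p..<q} = ennreal (q - p)"
  by (subst half_line_emeasure) auto

lemma half_line_sets_iff: "A \<in> sets half_line \<longleftrightarrow> A \<in> sets lebesgue \<and> A \<subseteq> {0..}"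
  by (subst sets_restrict_space_iff) auto

lemma complete_half_line: "complete_measure half_line"
proof
  fix A B assume B: "B \<subseteq> A" "A \<in> null_sets half_line"
  then have "A \<subseteq> {0..}" "A \<in> null_sets lebesgue"
    by (auto simp: null_sets_def half_line_sets_iff half_line_emeasure)
  then show "B \<in> sets half_line"
    using B(1) by (auto simp: half_line_sets_iff intro: null_sets_completion_subset[THEN null_setsD2])
qed

text \<open>The rays \<open>{..a}\<close> are stable under intersection and generate the Borel sets,
  so the distribution function determines the image measure there. A Lebesgue set differs from a
  Borel set by a null part, whose preimage is null and hence measurable because
  \<open>half_line\<close> is complete.\<close>

lemma mp_distrI:
  assumes phi: "\<phi> \<in> borel_measurable half_line" and nonneg: "\<And>x. 0 \<le> x \<Longrightarrow> 0 \<le> \<phi> x"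
    and le: "\<And>s. 0 \<le> s \<Longrightarrow> emeasure half_line {x. 0 \<le> x \<and> \<phi> x \<le> s} = ennreal s"
  shows "\<phi> \<in> half_line \<rightarrow>\<^sub>M half_line" and "distr half_line half_line \<phi> = half_line"
proof -
  interpret complete_measure half_line by (rule complete_half_line)
  \<comment> \<open>The identity is the reference: its image measure on \<open>borel\<close> is
    Lebesgue measure on the half line, against which that of \<phi> is compared.\<close>
  have id: "(\<lambda>x. x) \<in> borel_measurable half_line"
    by (intro borel_measurable_half_lineI) simp
  have meas': "\<phi> \<in> half_line \<rightarrow>\<^sub>M lborel" using phi by simp
  have interval: "emeasure half_line {0..s} = ennreal s" if "0 \<le> s" for s
    using that by (subst half_line_emeasure) auto
  have eq: "distr half_line borel \<phi> = distr half_line borel (\<lambda>x. x)"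
  proof (rule measure_eqI_generator_eq[where E = "range (\<lambda>a::real. {..a})" and \<Omega> = UNIV
        and A = "\<lambda>n. {..real n}"])
    show "Int_stable (range (\<lambda>a::real. {..a}))"
      by (auto simp: Int_stable_def)
    have "sets (borel :: real measure) = sets (sigma UNIV (range (\<lambda>a::real. {..a})))"
      by (rule arg_cong[OF borel_eq_atMost])
    also have "\<dots> = sigma_sets UNIV (range (\<lambda>a. {..a}))"
      by (rule sets_measure_of) simp
    finally show "sets (distr half_line borel \<phi>) = sigma_sets UNIV (range (\<lambda>a. {..a}))"
      "sets (distr half_line borel (\<lambda>x. x)) = sigma_sets UNIV (range (\<lambda>a. {..a::real}))"
      by simp_all
    have *: "emeasure (distr half_line borel \<phi>) {..a} = ennreal a"
      "emeasure (distr half_line borel (\<lambda>x. x)) {..a} = ennreal a" for a :: real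
    proof -
      have "\<phi> -` {..a} \<inter> {0..} = (if 0 \<le> a then {x. 0 \<le> x \<and> \<phi> x \<le> a} else {})"
        using nonneg by (auto intro: order_trans)
      then show "emeasure (distr half_line borel \<phi>) {..a} = ennreal a"
        using le[of a] by (simp add: emeasure_distr[OF phi] ennreal_neg)
      have "(\<lambda>x. x) -` {..a} \<inter> {0..} = (if 0 \<le> a then {0..a} else {})" by auto
      then show "emeasure (distr half_line borel (\<lambda>x. x)) {..a} = ennreal a"
        using interval[of a] by (simp add: emeasure_distr[OF id] ennreal_neg)
    qed
    show "emeasure (distr half_line borel \<phi>) X = emeasure (distr half_line borel (\<lambda>x. x)) X"
      if "X \<in> range (\<lambda>a. {..a})" for X
      using that * by auto
    show "emeasure (distr half_line borel \<phi>) {..real n} \<noteq> \<infinity>" for n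
      by (simp add: *)
  qed (auto intro: real_arch_simple)
  have borel_eq: "emeasure half_line (\<phi> -` S \<inter> {0..}) = emeasure lborel (S \<inter> {0..})"
    if "S \<in> sets borel" for S
  proof -
    have "emeasure half_line (\<phi> -` S \<inter> {0..}) = emeasure (distr half_line borel \<phi>) S"
      using that by (simp add: emeasure_distr[OF phi])
    also have "\<dots> = emeasure half_line (S \<inter> {0..})"
      unfolding eq using that by (simp add: emeasure_distr[OF id])
    also have "\<dots> = emeasure lborel (S \<inter> {0..})"
      using that by (subst half_line_emeasure) auto
    finally show ?thesis .
  qed
  \<comment> \<open>Null sets pull back to null sets, which upgrades Borel measurability of \<phi>
    to measurability for the completed sigma-algebra.\<close>
  have null: "null_sets lborel \<subseteq> null_sets (distr half_line lborel \<phi>)"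
  proof
    fix S :: "real set" assume S: "S \<in> null_sets lborel"
    then have "emeasure lborel (S \<inter> {0..}) = 0"
      using emeasure_mono[of "S \<inter> {0..}" S lborel] by (auto simp: null_sets_def)
    then show "S \<in> null_sets (distr half_line lborel \<phi>)"
      using S borel_eq[of S] by (auto simp: null_sets_def emeasure_distr[OF meas'])
  qed
  have "\<phi> \<in> half_line \<rightarrow>\<^sub>M lebesgue"
    by (rule measurable_completion2[OF meas' null])
  then show m: "\<phi> \<in> half_line \<rightarrow>\<^sub>M half_line"
    using nonneg by (intro measurable_restrict_space2) auto
  show "distr half_line half_line \<phi> = half_line"
  proof (rule measure_eqI)
    fix A assume "A \<in> sets (distr half_line half_line \<phi>)"
    then have A: "A \<in> sets half_line" "A \<in> sets lebesgue" "A \<subseteq> {0..}"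
      by (auto simp: half_line_sets_iff)
    let ?M = "main_part lborel A" and ?N = "null_part lborel A"
    have M: "?M \<in> sets borel" using main_part_sets[OF A(2)] by simp
    have AMN: "A = ?M \<union> ?N" using main_part_null_part_Un[OF A(2)] by simp
    have N: "\<phi> -` ?N \<inter> {0..} \<in> null_sets half_line"
      using vimage_null_part_null_sets[OF meas' null] A(2) by simp
    have Mset: "\<phi> -` ?M \<inter> {0..} \<in> sets half_line"
      using measurable_sets[OF phi M] by simp
    have "emeasure (distr half_line half_line \<phi>) A = emeasure half_line (\<phi> -` A \<inter> {0..})"
      using A(1) by (simp add: emeasure_distr[OF m])
    also have "\<phi> -` A \<inter> {0..} = (\<phi> -` ?M \<inter> {0..}) \<union> (\<phi> -` ?N \<inter> {0..})"
      by (subst AMN) auto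
    also have "emeasure half_line \<dots> = emeasure half_line (\<phi> -` ?M \<inter> {0..})"
      by (rule emeasure_Un_null_set[OF Mset N])
    also have "\<dots> = emeasure lborel (?M \<inter> {0..})" by (rule borel_eq[OF M])
    also have "?M \<inter> {0..} = ?M" using A(3) AMN by auto
    also have "emeasure lborel ?M = emeasure half_line A"
      using A(2,3) by (simp add: half_line_emeasure)
    finally show "emeasure (distr half_line half_line \<phi>) A = emeasure half_line A" .
  qed simp
qed

section \<open>Rank maps\<close>

text \<open>The probability integral transform for an infinite measure. \<open>F (e x)\<close> is
  the measure of the points that do not come after \<open>x\<close> in the order given by
  \<open>e\<close>; as no level of \<open>e\<close> carries mass, \<open>F\<close> is continuous and
  the rank is distributed like Lebesgue measure on the half line.\<close>

locale atomless_rank =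
  fixes e :: "real \<Rightarrow> real" and F :: "real \<Rightarrow> real"
  assumes e_meas [measurable]: "e \<in> borel_measurable half_line"
    and e_nonneg: "\<And>x. 0 \<le> x \<Longrightarrow> 0 \<le> e x"
    and finite_level: "\<And>t. emeasure half_line {x. 0 \<le> x \<and> e x \<le> t} < \<infinity>"
    and null_level: "\<And>t. emeasure half_line {x. 0 \<le> x \<and> e x = t} = 0"
    and F_def: "\<And>t. F t = measure half_line {x. 0 \<le> x \<and> e x \<le> t}"
begin

lemma level_sets [measurable]:
  "{x. 0 \<le> x \<and> e x \<le> t} \<in> sets half_line" "{x. 0 \<le> x \<and> e x < t} \<in> sets half_line"
  "{x. 0 \<le> x \<and> e x = t} \<in> sets half_line"
proof -
  have "{x\<in>space half_line. e x \<le> t} \<in> sets half_line" "{x\<in>space half_line. e x < t} \<in> sets half_line"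
    "{x\<in>space half_line. e x = t} \<in> sets half_line" by measurable
  then show "{x. 0 \<le> x \<and> e x \<le> t} \<in> sets half_line" "{x. 0 \<le> x \<and> e x < t} \<in> sets half_line"
    "{x. 0 \<le> x \<and> e x = t} \<in> sets half_line" by simp_all
qed

lemma emeasure_level: "emeasure half_line {x. 0 \<le> x \<and> e x \<le> t} = ennreal (F t)"
  unfolding F_def by (rule emeasure_eq_ennreal_measure) (use finite_level[of t] in auto)

lemma emeasure_strict_level: "emeasure half_line {x. 0 \<le> x \<and> e x < t} = ennreal (F t)"
proof -
  have "emeasure half_line ({x. 0 \<le> x \<and> e x < t} \<union> {x. 0 \<le> x \<and> e x = t}) = emeasure half_line {x. 0 \<le> x \<and> e x < t}"
    using null_level[of t] by (intro emeasure_Un_null_set) (auto simp: null_sets_def)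
  also have "{x. 0 \<le> x \<and> e x < t} \<union> {x. 0 \<le> x \<and> e x = t} = {x. 0 \<le> x \<and> e x \<le> t}" by auto
  finally show ?thesis by (simp add: emeasure_level)
qed

lemma F_eq_strict: "F t = measure half_line {x. 0 \<le> x \<and> e x < t}"
  using emeasure_strict_level[of t] by (simp add: measure_def F_def)

lemma F_nonneg: "0 \<le> F t" by (simp add: F_def)

lemma F_mono: "mono F"
proof
  fix s t :: real assume "s \<le> t"
  then have "emeasure half_line {x. 0 \<le> x \<and> e x \<le> s} \<le> emeasure half_line {x. 0 \<le> x \<and> e x \<le> t}"
    by (intro emeasure_mono) auto
  then show "F s \<le> F t" by (simp add: emeasure_level F_nonneg)
qed

lemma F_right: "(\<lambda>n. F (t + 1 / real (Suc n))) \<longlonglongrightarrow> F t"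
proof -
  have "(\<lambda>n. measure half_line {x. 0 \<le> x \<and> e x \<le> t + 1 / real (Suc n)})
      \<longlonglongrightarrow> measure half_line (\<Inter>n. {x. 0 \<le> x \<and> e x \<le> t + 1 / real (Suc n)})"
  proof (rule Lim_measure_decseq)
    show "decseq (\<lambda>n. {x. 0 \<le> x \<and> e x \<le> t + 1 / real (Suc n)})"
    proof (rule decseq_SucI, safe)
      fix n x assume "e x \<le> t + 1 / real (Suc (Suc n))"
      also have "\<dots> \<le> t + 1 / real (Suc n)" by (intro add_left_mono divide_left_mono) auto
      finally show "e x \<le> t + 1 / real (Suc n)" .
    qed
  qed (use finite_level in \<open>auto simp: less_top\<close>)
  also have "(\<Inter>n. {x. 0 \<le> x \<and> e x \<le> t + 1 / real (Suc n)}) = {x. 0 \<le> x \<and> e x \<le> t}"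
  proof safe
    fix x assume *: "x \<in> (\<Inter>n. {x. 0 \<le> x \<and> e x \<le> t + 1 / real (Suc n)})"
    then show "0 \<le> x" by auto
    have "(\<lambda>n. t + 1 / real (Suc n)) \<longlonglongrightarrow> t + 0"
      by (intro tendsto_add tendsto_const LIMSEQ_Suc[OF lim_1_over_n])
    then show "e x \<le> t" using * by (intro LIMSEQ_le_const[of _ t]) auto
  qed (auto intro: order_trans)
  finally show ?thesis by (simp add: F_def)
qed

text \<open>Here the absence of atoms enters: the lower levels increase only to the strict level
  set, which has full measure in the level \<open>t\<close>.\<close>

lemma F_left: "(\<lambda>n. F (t - 1 / real (Suc n))) \<longlonglongrightarrow> F t"
proof -
  have U: "(\<Union>n. {x. 0 \<le> x \<and> e x \<le> t - 1 / real (Suc n)}) = {x. 0 \<le> x \<and> e x < t}"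
  proof safe
    fix x n assume "e x \<le> t - 1 / real (Suc n)"
    also have "\<dots> < t" by simp
    finally show "e x < t" .
  next
    fix x assume x: "e x < t" "0 \<le> x"
    then obtain n where "1 / real (Suc n) < t - e x"
      using reals_Archimedean[of "t - e x"] by (auto simp: inverse_eq_divide)
    then show "x \<in> (\<Union>n. {x. 0 \<le> x \<and> e x \<le> t - 1 / real (Suc n)})"
      using x by (auto intro!: exI[of _ n])
  qed
  have "(\<lambda>n. measure half_line {x. 0 \<le> x \<and> e x \<le> t - 1 / real (Suc n)})
      \<longlonglongrightarrow> measure half_line (\<Union>n. {x. 0 \<le> x \<and> e x \<le> t - 1 / real (Suc n)})"
  proof (rule Lim_measure_incseq)
    show "incseq (\<lambda>n. {x. 0 \<le> x \<and> e x \<le> t - 1 / real (Suc n)})"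
    proof (rule incseq_SucI, safe)
      fix n x assume "e x \<le> t - 1 / real (Suc n)"
      also have "\<dots> \<le> t - 1 / real (Suc (Suc n))" by (intro diff_left_mono divide_left_mono) auto
      finally show "e x \<le> t - 1 / real (Suc (Suc n))" .
    qed
    show "emeasure half_line (\<Union>n. {x. 0 \<le> x \<and> e x \<le> t - 1 / real (Suc n)}) \<noteq> \<infinity>"
      unfolding U by (simp add: emeasure_strict_level)
  qed auto
  then show ?thesis unfolding U by (simp only: F_def[symmetric] F_eq_strict[symmetric])
qed

lemma F_0: "F 0 = 0"
proof -
  have "{x. 0 \<le> x \<and> e x \<le> 0} = {x. 0 \<le> x \<and> e x = 0}" using e_nonneg by force
  then show ?thesis using null_level[of 0] by (simp add: F_def measure_def)
qed

text \<open>The levels exhaust the half line, which has infinite measure. This bounds the set whose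
  supremum defines \<open>G\<close>.\<close>

lemma F_unbounded: "\<exists>t. s < F t"
proof (rule ccontr)
  assume "\<not> ?thesis"
  then have F: "F t \<le> s" for t by (simp add: not_less)
  have "(\<lambda>n. emeasure half_line {x. 0 \<le> x \<and> e x \<le> real n})
     \<longlonglongrightarrow> emeasure half_line (\<Union>n. {x. 0 \<le> x \<and> e x \<le> real n})"
    by (rule Lim_emeasure_incseq) (auto simp: incseq_def)
  moreover have "(\<Union>n. {x. 0 \<le> x \<and> e x \<le> real n}) = {0..}" by (auto intro: real_arch_simple)
  ultimately have "emeasure half_line {0..} \<le> ennreal s"
    using F by (intro LIMSEQ_le_const2) (auto simp: emeasure_level ennreal_leI)
  moreover have "ennreal (max 0 s + 1) = emeasure half_line {0..max 0 s + 1}"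
    by (subst half_line_emeasure) auto
  moreover have "emeasure half_line {0..max 0 s + 1} \<le> emeasure half_line {0..}"
    by (intro emeasure_mono) (auto simp: half_line_sets_iff)
  ultimately have "ennreal (max 0 s + 1) \<le> ennreal s" by (metis order_trans)
  then show False by (auto simp: ennreal_le_iff2 max_def split: if_splits)
qed

text \<open>The quantile function of \<open>F\<close>. Replacing \<open>s\<close> by
  \<open>max 0 s\<close> keeps the set nonempty for negative \<open>s\<close>, so \<open>G\<close>
  is monotone on all reals and therefore Borel.\<close>

definition G :: "real \<Rightarrow> real" where
  "G s = Sup {t. F t \<le> max 0 s}"

lemma G_set: "{t. F t \<le> max 0 s} \<noteq> {}" "bdd_above {t. F t \<le> max 0 s}"
proof -
  show "{t. F t \<le> max 0 s} \<noteq> {}" using F_0 by (auto intro!: exI[of _ 0])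
  obtain u where "max 0 s < F u" using F_unbounded by blast
  then have "t \<le> u" if "F t \<le> max 0 s" for t
    using monoD[OF F_mono, of u t] that by linarith
  then show "bdd_above {t. F t \<le> max 0 s}" by (intro bdd_aboveI[of _ u]) auto
qed

text \<open>By continuity of \<open>F\<close>: its values just below the supremum are at most
  \<open>s\<close>, those just above exceed \<open>s\<close>.\<close>

lemma F_G:
  assumes "0 \<le> s" shows "F (G s) = s"
proof (rule antisym)
  have "F (G s - 1 / real (Suc n)) \<le> s" for n
  proof -
    have "G s - 1 / real (Suc n) < Sup {t. F t \<le> max 0 s}" by (simp add: G_def)
    then obtain t where "F t \<le> max 0 s" "G s - 1 / real (Suc n) < t"
      using less_cSup_iff[OF G_set] by blast
    then show ?thesis using monoD[OF F_mono, of "G s - 1 / real (Suc n)" t] assms by simp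
  qed
  then show "F (G s) \<le> s" by (intro LIMSEQ_le_const2[OF F_left]) auto
  have "s \<le> F (G s + 1 / real (Suc n))" for n
  proof (rule ccontr)
    assume "\<not> ?thesis"
    then have "G s + 1 / real (Suc n) \<le> Sup {t. F t \<le> max 0 s}"
      by (intro cSup_upper G_set) auto
    then show False by (simp add: G_def)
  qed
  then show "s \<le> F (G s)" by (intro LIMSEQ_le_const[OF F_right]) auto
qed

text \<open>The Galois connection that turns a level set of the rank into a level set of
  \<open>e\<close>, whose measure is \<open>F (G s) = s\<close>.\<close>

lemma F_le_iff: "0 \<le> s \<Longrightarrow> F t \<le> s \<longleftrightarrow> t \<le> G s"
proof
  assume s: "0 \<le> s"
  show "F t \<le> s \<Longrightarrow> t \<le> G s"
    unfolding G_def by (rule cSup_upper[OF _ G_set(2)]) simp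
  show "t \<le> G s \<Longrightarrow> F t \<le> s"
    using monoD[OF F_mono, of t "G s"] F_G[OF s] by simp
qed

lemma G_mono: "mono G"
  unfolding G_def by (intro monoI cSup_subset_mono G_set) auto

lemma F_e_meas: "(\<lambda>x. F (e x)) \<in> borel_measurable half_line"
  using measurable_compose[OF e_meas borel_measurable_mono[OF F_mono]] .

lemma F_e_distr:
  "(\<lambda>x. F (e x)) \<in> half_line \<rightarrow>\<^sub>M half_line"
  "distr half_line half_line (\<lambda>x. F (e x)) = half_line"
proof -
  have "emeasure half_line {x. 0 \<le> x \<and> F (e x) \<le> s} = ennreal s" if "0 \<le> s" for s
    using that by (simp add: F_le_iff emeasure_level F_G)
  then show "(\<lambda>x. F (e x)) \<in> half_line \<rightarrow>\<^sub>M half_line"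
    "distr half_line half_line (\<lambda>x. F (e x)) = half_line"
    using mp_distrI[OF F_e_meas] F_nonneg by blast+
qed

lemma F_e_neq_AE: "AE x in half_line. F (e x) \<noteq> s"
proof (rule AE_distrD[OF F_e_distr(1)])
  have "AE y in half_line. y \<noteq> s"
    unfolding AE_half_line_iff
    using AE_completion[OF AE_lborel_singleton[of s]] by eventually_elim auto
  then show "AE y in distr half_line half_line (\<lambda>x. F (e x)). y \<noteq> s"
    by (subst F_e_distr(2))
qed

text \<open>\<open>F\<close> may be flat, so \<open>e x < t\<close> gives only
  \<open>F (e x) \<le> F t\<close>. Equality happens on a null set, because the rank takes each
  single value with measure zero.\<close>

lemma F_e_less_iff_AE: "AE x in half_line. F (e x) < F t \<longleftrightarrow> e x < t"
  using F_e_neq_AE[of "F t"]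
proof eventually_elim
  case (elim x)
  then show ?case using monoD[OF F_mono, of "e x" t] monoD[OF F_mono, of t "e x"]
    by (cases "e x < t") auto
qed

text \<open>If \<open>e x\<close> were smaller than \<open>G (F (e x))\<close>, a rational in
  between would lie on a flat piece of \<open>F\<close> beginning at \<open>e x\<close>. Rationals
  are countable, so one null set excludes all of these.\<close>

lemma G_F_AE: "AE x in half_line. G (F (e x)) = e x"
proof -
  have "AE x in half_line. \<forall>r\<in>\<rat>. F (e x) < F r \<longleftrightarrow> e x < r"
    using F_e_less_iff_AE by (intro AE_ball_countable[THEN iffD2] countable_rat) auto
  then show ?thesis
  proof eventually_elim
    case (elim x)
    have "e x \<le> G (F (e x))" using F_le_iff[OF F_nonneg, of "e x" "e x"] by simp
    moreover have False if less: "e x < G (F (e x))"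
    proof -
      obtain r where r: "r \<in> \<rat>" "e x < r" "r < G (F (e x))"
        using Rats_dense_in_real[OF less] by blast
      then have "F r \<le> F (e x)" by (simp add: F_le_iff[OF F_nonneg])
      then show False using elim r by force
    qed
    ultimately show ?case by force
  qed
qed

text \<open>\<open>G\<close> recovers the key \<open>e x\<close> from the rank and \<open>h\<close>
  recovers the point from its key, so \<open>h\<close> after \<open>G\<close> is the almost
  everywhere inverse.\<close>

lemma mp_map_rank:
  assumes "h \<in> borel_measurable borel" "\<And>x. 0 \<le> x \<Longrightarrow> h (e x) = x"
  shows "mp_map (\<lambda>x. F (e x))"
proof -
  have "(\<lambda>y. h (G y)) \<in> borel_measurable borel"
    by (rule measurable_compose[OF borel_measurable_mono[OF G_mono] assms(1)])
  moreover have "AE x in half_line. 0 \<le> x" by (simp add: AE_half_line_iff)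
  then have "AE x in half_line. h (G (F (e x))) = x"
    using G_F_AE by eventually_elim (simp add: assms(2))
  ultimately show ?thesis
    unfolding mp_map_def by (intro conjI F_e_distr bexI)
qed

end

text \<open>
  Points are ordered by the number of sets that miss them, then by position; \<open>e\<close> encodes this order
  in one real, and the rank of a point in it is the required map.
\<close>

lemma nested_sets_mp_map:
  fixes B :: "nat \<Rightarrow> real set"
  assumes sets: "\<And>j. B j \<in> sets half_line" and dec: "decseq B"
    and fin: "emeasure half_line (B 0) < \<infinity>"
  obtains \<phi> where "mp_map \<phi>"
    "\<And>j. j < k \<Longrightarrow> AE x in half_line. \<phi> x < measure half_line (B j) \<longleftrightarrow> x \<in> B j"
proof -
  define c where "c x = card {j. j < k \<and> x \<notin> B j}" for x
  \<comment> \<open>\<open>x / (1 + x)\<close> stays below 1, so the integer part decides first and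
    position second. Outside \<open>B 0\<close> the position is kept uncompressed: otherwise a
    single level would contain almost the whole half line and have infinite measure.\<close>
  define e where "e x = (if x \<in> B 0 \<and> 0 < k then real (c x) + x / (1 + x) else real k + x)" for x
  define h where "h t = (if real k \<le> t then t - real k else frac t / (1 - frac t))" for t
  have frac: "0 \<le> x / (1 + x)" "x / (1 + x) < 1" if "0 \<le> x" for x :: real
    using that by (auto simp: divide_simps)
  have c_less: "c x < k - j" if "x \<in> B j" "j < k" for x j
  proof -
    have "x \<in> B i" if "i \<le> j" for i using decseqD[OF dec that] \<open>x \<in> B j\<close> by blast
    then have "{j. j < k \<and> x \<notin> B j} \<subseteq> {Suc j..<k}" by (auto simp: not_less_eq_eq[symmetric])
    then have "c x \<le> card {Suc j..<k}" unfolding c_def by (intro card_mono) auto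
    with that show ?thesis by simp
  qed
  have c_ge: "k - j \<le> c x" if "x \<notin> B j" "j < k" for x j
  proof -
    have "x \<notin> B i" if "j \<le> i" for i using decseqD[OF dec that] \<open>x \<notin> B j\<close> by blast
    then have "{j..<k} \<subseteq> {j. j < k \<and> x \<notin> B j}" by auto
    then have "card {j..<k} \<le> c x" unfolding c_def by (intro card_mono) auto
    then show ?thesis by simp
  qed
  have e_less_iff: "e x < real (k - j) \<longleftrightarrow> x \<in> B j" if "0 \<le> x" "j < k" for x j
  proof (cases "x \<in> B 0")
    case True
    then have e: "e x = real (c x) + x / (1 + x)" using that by (simp add: e_def)
    show ?thesis
    proof
      assume "x \<in> B j"
      then have "real (c x) + 1 \<le> real (k - j)" using c_less[of x j] that by linarith
      then show "e x < real (k - j)" using frac[OF that(1)] e by linarith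
    next
      assume *: "e x < real (k - j)"
      show "x \<in> B j"
      proof (rule ccontr)
        assume "x \<notin> B j"
        then have "real (k - j) \<le> real (c x)" using c_ge[of x j] that by simp
        then show False using frac[OF that(1)] e * by linarith
      qed
    qed
  next
    case False
    then have "x \<notin> B j" using decseqD[OF dec, of 0 j] by auto
    moreover have "real (k - j) \<le> e x" using False that by (simp add: e_def)
    ultimately show ?thesis by auto
  qed
  have h_e: "h (e x) = x" if "0 \<le> x" for x
  proof (cases "x \<in> B 0 \<and> 0 < k")
    case True
    then have "e x < real k" using e_less_iff[of x 0] that by simp
    moreover have "frac (e x) = x / (1 + x)"
      using True frac[OF that] by (simp add: e_def frac_unique_iff)
    moreover have "x / (1 + x) / (1 - x / (1 + x)) = x" using that by (simp add: field_simps)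
    ultimately show ?thesis by (simp add: h_def)
  next
    case False
    then show ?thesis using that by (auto simp: h_def e_def)
  qed
  define F where "F t = measure half_line {x. 0 \<le> x \<and> e x \<le> t}" for t
  interpret atomless_rank e F
  proof
    have "(\<lambda>x. \<Sum>j<k. 1 - indicator (B j) x :: real) \<in> borel_measurable half_line"
      using sets by measurable
    also have "(\<lambda>x. \<Sum>j<k. 1 - indicator (B j) x :: real) = (\<lambda>x. real (c x))"
    proof
      fix x
      have "(\<Sum>j<k. 1 - indicator (B j) x :: real) = (\<Sum>j<k. if x \<notin> B j then 1 else 0)"
        by (rule sum.cong) (auto simp: indicator_def)
      also have "\<dots> = real (card ({..<k} \<inter> {j. x \<notin> B j}))" by (simp add: sum.If_cases)
      also have "{..<k} \<inter> {j. x \<notin> B j} = {j. j < k \<and> x \<notin> B j}" by auto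
      finally show "(\<Sum>j<k. 1 - indicator (B j) x :: real) = real (c x)" by (simp add: c_def)
    qed
    finally have [measurable]: "(\<lambda>x. real (c x)) \<in> borel_measurable half_line" .
    have [measurable]: "(\<lambda>x. x) \<in> borel_measurable half_line"
      by (intro borel_measurable_half_lineI) simp
    have [measurable]: "B 0 \<in> sets half_line" by (rule sets)
    show e_meas: "e \<in> borel_measurable half_line"
      unfolding e_def by measurable
    show "0 \<le> e x" if "0 \<le> x" for x using frac[OF that] that by (auto simp: e_def)
    show "emeasure half_line {x. 0 \<le> x \<and> e x \<le> t} < \<infinity>" for t
    proof -
      have "emeasure half_line {x. 0 \<le> x \<and> e x \<le> t} \<le> emeasure half_line (B 0 \<union> {0..t})"
        by (rule emeasure_mono) (use sets in \<open>auto simp: e_def half_line_sets_iff split: if_splits\<close>)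
      also have "\<dots> \<le> emeasure half_line (B 0) + emeasure half_line {0..t}"
        by (rule emeasure_subadditive) (use sets in \<open>auto simp: half_line_sets_iff\<close>)
      also have "\<dots> < \<infinity>"
        using fin by (cases "0 \<le> t") (auto simp: half_line_emeasure ennreal_add_less_top)
      finally show ?thesis .
    qed
    show "emeasure half_line {x. 0 \<le> x \<and> e x = t} = 0" for t
    proof -
      \<comment> \<open>\<open>h\<close> inverts \<open>e\<close>, so a level contains at most one
        point.\<close>
      have "emeasure half_line {x. 0 \<le> x \<and> e x = t} \<le> emeasure half_line ({h t} \<inter> {0..})"
        by (rule emeasure_mono) (auto simp: h_e half_line_sets_iff)
      also have "\<dots> = 0"
        by (subst half_line_emeasure) (auto simp: Int_insert_left)
      finally show ?thesis by simp
    qed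
  qed (rule F_def)
  have "(\<lambda>t. frac t) \<in> borel_measurable (borel :: real measure)"
    unfolding frac_def by measurable
  then have "h \<in> borel_measurable borel" unfolding h_def by measurable
  then have "mp_map (\<lambda>x. F (e x))" using h_e by (rule mp_map_rank)
  moreover have "AE x in half_line. F (e x) < measure half_line (B j) \<longleftrightarrow> x \<in> B j" if "j < k" for j
  proof -
    \<comment> \<open>Points of \<open>B j\<close> miss fewer than \<open>k - j\<close> of the sets,
      by nesting, so the key threshold \<open>k - j\<close> corresponds to the rank threshold
      \<open>measure half_line (B j)\<close>.\<close>
    have "{x. 0 \<le> x \<and> e x < real (k - j)} = B j"
      using e_less_iff[OF _ that] sets[of j] by (auto simp: half_line_sets_iff)
    then have "F (real (k - j)) = measure half_line (B j)" by (simp add: F_eq_strict)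
    then have "AE x in half_line. F (e x) < measure half_line (B j) \<longleftrightarrow> e x < real (k - j)"
      using F_e_less_iff_AE[of "real (k - j)"] by simp
    moreover have "AE x in half_line. 0 \<le> x" by (simp add: AE_half_line_iff)
    ultimately show ?thesis
      by eventually_elim (simp add: e_less_iff[OF _ that])
  qed
  ultimately show thesis by (rule that)
qed

section \<open>Equimeasurability\<close>

lemma J_level_set:
  assumes T: "T \<in> J" and y: "0 \<le> y"
  shows "{x. 0 \<le> x \<and> y < cmod (T x)} \<in> sets half_line"
    and "emeasure half_line {x. 0 \<le> x \<and> y < cmod (T x)} < \<infinity>"
proof -
  have [measurable]: "T \<in> borel_measurable half_line" by (rule J_measurable[OF T])
  have "{x \<in> space half_line. y < cmod (T x)} \<in> sets half_line" by measurable
  then show sets: "{x. 0 \<le> x \<and> y < cmod (T x)} \<in> sets half_line" by simp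
  from T obtain A where A: "A \<in> sets half_line" "emeasure half_line A < \<infinity>"
    "AE x in half_line. x \<notin> A \<longrightarrow> T x = 0"
    unfolding J_def by blast
  have "emeasure half_line {x. 0 \<le> x \<and> y < cmod (T x)} \<le> emeasure half_line A"
    by (rule emeasure_mono_AE[OF _ A(1)]) (use A(3) y in \<open>auto elim!: eventually_mono\<close>)
  then show "emeasure half_line {x. 0 \<le> x \<and> y < cmod (T x)} < \<infinity>"
    using A(2) by (rule le_less_trans)
qed

lemma measure_half_line_interval [simp]:
  "0 \<le> b \<Longrightarrow> measure half_line {0..<b} = b"
  "0 \<le> b \<Longrightarrow> emeasure half_line {0..<b} = ennreal b"
  by (simp_all add: measure_def emeasure_half_line_Ico)

text \<open>The sum counts the multiples of \<epsilon> strictly below \<open>v\<close>; there are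
  \<open>m\<close>, the ceiling of \<open>v / \<epsilon>\<close>, and omitting \<open>j = 0\<close>
  removes one. The error in the upper bound is switched off at \<open>v = 0\<close>, so that for
  \<open>v = cmod (T x)\<close> it is carried by a set of finite measure and belongs to
  \<open>J\<close>.\<close>

lemma sum_layers:
  fixes v \<epsilon> :: real
  assumes \<epsilon>: "0 < \<epsilon>" and v: "0 \<le> v" "v \<le> \<epsilon> * real k"
  shows "v \<le> (\<Sum>j<k. \<epsilon> * indicator {y. real j * \<epsilon> < y} v)"
    and "(\<Sum>j<k. \<epsilon> * indicator {y. real j * \<epsilon> < y} v) \<le> v + \<epsilon> * indicator {0<..} v"
    and "(\<Sum>j\<in>{1..<k}. \<epsilon> * indicator {y. real j * \<epsilon> < y} v) \<le> v"
proof -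
  define m where "m = nat \<lceil>v / \<epsilon>\<rceil>"
  have m: "v / \<epsilon> \<le> real m" "real m < v / \<epsilon> + 1"
    using v \<epsilon> unfolding m_def by (auto simp: of_nat_ceiling) linarith
  have "v / \<epsilon> \<le> real k" using v \<epsilon> by (simp add: divide_simps mult.commute)
  then have mk: "m \<le> k" unfolding m_def by (simp add: ceiling_le_iff nat_le_iff)
  have less: "real j * \<epsilon> < v \<longleftrightarrow> j < m" for j
  proof -
    have "real j * \<epsilon> < v \<longleftrightarrow> real j < v / \<epsilon>" using \<epsilon> by (simp add: pos_less_divide_eq)
    also have "\<dots> \<longleftrightarrow> j < m" using m by linarith
    finally show ?thesis .
  qed
  have "(\<Sum>j\<in>A. \<epsilon> * indicator {y. real j * \<epsilon> < y} v) = \<epsilon> * real (card (A \<inter> {..<m}))" if "finite A" for A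
  proof -
    have "(\<Sum>j\<in>A. \<epsilon> * indicator {y. real j * \<epsilon> < y} v) = (\<Sum>j\<in>A. if j \<in> {..<m} then \<epsilon> else 0)"
      by (rule sum.cong) (auto simp: less)
    also have "\<dots> = (\<Sum>j\<in>A \<inter> {..<m}. \<epsilon>)" using that by (rule sum.inter_restrict[symmetric])
    finally show ?thesis by (simp add: mult.commute)
  qed
  note sum = this
  have "{..<k} \<inter> {..<m} = {..<m}" "{1..<k} \<inter> {..<m} = {1..<m}" using mk by auto
  then have s: "(\<Sum>j<k. \<epsilon> * indicator {y. real j * \<epsilon> < y} v) = \<epsilon> * real m"
    "(\<Sum>j\<in>{1..<k}. \<epsilon> * indicator {y. real j * \<epsilon> < y} v) = \<epsilon> * real (m - 1)"
    using sum[of "{..<k}"] sum[of "{1..<k}"]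
    by (simp_all only: finite_lessThan finite_atLeastLessThan card_lessThan card_atLeastLessThan simp_thms)
  show "v \<le> (\<Sum>j<k. \<epsilon> * indicator {y. real j * \<epsilon> < y} v)"
    using m(1) \<epsilon> unfolding s by (simp add: divide_simps mult.commute)
  have m': "\<epsilon> * real m \<le> v + \<epsilon>"
    using m(2) \<epsilon> by (simp add: field_simps)
  show "(\<Sum>j<k. \<epsilon> * indicator {y. real j * \<epsilon> < y} v) \<le> v + \<epsilon> * indicator {0<..} v"
    using m' v unfolding s by (cases "v = 0") (auto simp: m_def)
  show "(\<Sum>j\<in>{1..<k}. \<epsilon> * indicator {y. real j * \<epsilon> < y} v) \<le> v"
    using m' v unfolding s by (cases m) (auto simp: algebra_simps)
qed

lemma le_of_forall_eps:
  fixes a b c :: real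
  assumes "\<And>\<epsilon>. 0 < \<epsilon> \<Longrightarrow> a \<le> b + \<epsilon> * c" "0 \<le> c"
  shows "a \<le> b"
proof (rule field_le_epsilon)
  fix \<delta> :: real assume "0 < \<delta>"
  then have "a \<le> b + \<delta> / (c + 1) * c" using assms by (intro assms(1)) auto
  also have "\<delta> / (c + 1) * c \<le> \<delta>" using \<open>0 < \<delta>\<close> assms(2) by (simp add: divide_simps)
  finally show "a \<le> b + \<delta>" by simp
qed

lemma J_step:
  assumes "\<And>j. j \<in> I \<Longrightarrow> B j \<in> sets half_line" "\<And>j. j \<in> I \<Longrightarrow> emeasure half_line (B j) < \<infinity>" "finite I"
  shows "(\<lambda>x. of_real (\<Sum>j\<in>I. a j * indicator (B j) x)) \<in> J"
proof -
  have "(\<lambda>x. \<Sum>j\<in>I. of_real (a j) * of_real (indicator (B j) x)) \<in> J"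
    by (intro J_sum assms J_scale J_indicator)
  then show ?thesis by simp
qed

context symmetric_gauge
begin

text \<open>The rank map sends \<open>B j\<close> onto \<open>{0..<measure half_line (B j)}\<close>
  for all \<open>j < k\<close> at once, so the step function over the intervals, composed with it,
  is the original one.\<close>

lemma N_step_rearrange:
  assumes sets: "\<And>j. B j \<in> sets half_line" and dec: "decseq B"
    and fin: "emeasure half_line (B 0) < \<infinity>"
  shows "N (\<lambda>x. of_real (\<Sum>j<k. a j * indicator (B j) x))
    = N (\<lambda>x. of_real (\<Sum>j<k. a j * indicator {0..<measure half_line (B j)} x))"
proof -
  let ?S = "\<lambda>x. complex_of_real (\<Sum>j<k. a j * indicator (B j) x)"
  let ?U = "\<lambda>x. complex_of_real (\<Sum>j<k. a j * indicator {0..<measure half_line (B j)} x)"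
  obtain \<phi> where \<phi>: "mp_map \<phi>"
    "\<And>j. j < k \<Longrightarrow> AE x in half_line. \<phi> x < measure half_line (B j) \<longleftrightarrow> x \<in> B j"
    using nested_sets_mp_map[OF sets dec fin] by blast
  have finB: "emeasure half_line (B j) < \<infinity>" for j
    using emeasure_mono[OF decseqD[OF dec, of 0 j] sets] fin by (auto intro: le_less_trans)
  have S: "?S \<in> J" by (intro J_step sets finB) simp
  have U: "?U \<in> J" by (intro J_step) (auto simp: half_line_sets_iff)
  have U\<phi>: "(\<lambda>x. ?U (\<phi> x)) =\<^sub>a ?S"
  proof -
    have "AE x in half_line. \<forall>j\<in>{..<k}. \<phi> x < measure half_line (B j) \<longleftrightarrow> x \<in> B j"
      using \<phi>(2) by (subst AE_ball_countable) auto
    moreover have "AE x in half_line. 0 \<le> \<phi> x"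
      by (rule mp_map_AE[OF \<phi>(1)]) (simp add: AE_half_line_iff)
    ultimately show ?thesis
      unfolding ae_eq_def by eventually_elim (auto intro!: sum.cong simp: indicator_def)
  qed
  have "(\<lambda>x. ?U (\<phi> x)) \<in> borel_measurable half_line"
    using mp_map_Linf[OF \<phi>(1) J_subset_Linf[OF U]] by (simp add: Linf_def)
  then have "(\<lambda>x. ?U (\<phi> x)) \<in> J" by (rule J_cong_AE[OF S _ U\<phi>])
  then have "N ?S = N (\<lambda>x. ?U (\<phi> x))" by (rule N_cong[OF _ S U\<phi>, symmetric])
  also have "\<dots> = N ?U" by (rule N_mp_map[OF \<phi>(1) U])
  finally show ?thesis .
qed

text \<open>Level sets of \<open>S\<close> and \<open>T\<close> are unrelated as sets, but once both
  are moved to intervals starting at \<open>0\<close>, smaller measure means inclusion and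
  monotonicity of the norm applies. The rounding costs \<epsilon> times the norm of a fixed
  indicator.\<close>

lemma N_le_of_distribution_le:
  assumes S: "S \<in> J" and T: "T \<in> J"
    and le: "\<And>y. 0 \<le> y \<Longrightarrow> measure half_line {x. 0 \<le> x \<and> y < cmod (S x)}
                 \<le> measure half_line {x. 0 \<le> x \<and> y < cmod (T x)}"
  shows "N S \<le> N T"
proof (rule le_of_forall_eps)
  let ?X = "\<lambda>x. complex_of_real (indicator {x. 0 \<le> x \<and> 0 < cmod (T x)} x)"
  have X: "?X \<in> J" by (intro J_indicator J_level_set[OF T]) simp_all
  show "0 \<le> N ?X" by (rule N_nonneg[OF X])
  fix \<epsilon> :: real assume \<epsilon>: "0 < \<epsilon>"
  from S T obtain C D where C: "AE x in half_line. cmod (S x) \<le> C"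
    and D: "AE x in half_line. cmod (T x) \<le> D"
    unfolding J_def Linf_def by blast
  obtain k :: nat where "max C D / \<epsilon> \<le> real k" using real_arch_simple by blast
  then have k: "C \<le> \<epsilon> * real k" "D \<le> \<epsilon> * real k"
    using \<epsilon> by (simp_all add: divide_simps mult.commute)
  define B where "B R j = {x. 0 \<le> x \<and> real j * \<epsilon> < cmod (R x)}" for R :: "real \<Rightarrow> complex" and j
  have sets: "B R j \<in> sets half_line" "emeasure half_line (B R j) < \<infinity>" if "R \<in> J" for R j
    unfolding B_def using \<epsilon> that by (intro J_level_set; simp)+
  have dec: "decseq (B R)" for R :: "real \<Rightarrow> complex"
  proof (rule decseq_SucI, unfold B_def, safe)
    fix j x assume "real (Suc j) * \<epsilon> < cmod (R x)"
    then show "real j * \<epsilon> < cmod (R x)" using \<epsilon> by (simp add: algebra_simps)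
  qed
  \<comment> \<open>\<open>P R\<close> rounds \<open>cmod (R x)\<close> up to a multiple of
    \<epsilon>, capped at \<open>k * \<epsilon>\<close>; \<open>Q R\<close> has the same layers
    pushed to intervals.\<close>
  define P where "P R x = complex_of_real (\<Sum>j<k. \<epsilon> * indicator (B R j) x)" for R x
  define Q where "Q R x = complex_of_real (\<Sum>j<k. \<epsilon> * indicator {0..<measure half_line (B R j)} x)" for R x
  have PJ: "P R \<in> J" if "R \<in> J" for R unfolding P_def by (intro J_step sets that) simp
  have QJ: "Q R \<in> J" for R
    unfolding Q_def by (intro J_step) (auto simp: half_line_sets_iff)
  have PQ: "N (P R) = N (Q R)" if "R \<in> J" for R
    unfolding P_def Q_def by (intro N_step_rearrange sets that dec)
  have P_eq: "P R x = complex_of_real (\<Sum>j<k. \<epsilon> * indicator {y. real j * \<epsilon> < y} (cmod (R x)))"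
    if "0 \<le> x" for R x
    using that by (auto simp: P_def B_def indicator_def)
  have pos: "AE x in half_line. 0 \<le> x" by (simp add: AE_half_line_iff)
  have "N S \<le> N (P S)"
  proof (rule N_mono[OF S PJ[OF S]])
    show "AE x in half_line. cmod (S x) \<le> cmod (P S x)"
      using C pos
    proof eventually_elim
      case (elim x)
      have "cmod (S x) \<le> (\<Sum>j<k. \<epsilon> * indicator {y. real j * \<epsilon> < y} (cmod (S x)))"
        using \<epsilon> elim k by (intro sum_layers) auto
      then show ?case unfolding P_eq[OF elim(2)] norm_of_real by linarith
    qed
  qed
  also have "N (P S) \<le> N (Q T)"
    unfolding PQ[OF S]
  proof (rule N_mono[OF QJ QJ], rule AE_I2)
    fix x
    have "(\<Sum>j<k. \<epsilon> * indicator {0..<measure half_line (B S j)} x)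
       \<le> (\<Sum>j<k. \<epsilon> * indicator {0..<measure half_line (B T j)} x)"
    proof (intro sum_mono mult_left_mono)
      fix j
      have "measure half_line (B S j) \<le> measure half_line (B T j)"
        unfolding B_def using \<epsilon> by (intro le) simp
      then show "indicator {0..<measure half_line (B S j)} x \<le> (indicator {0..<measure half_line (B T j)} x :: real)"
        by (auto simp: indicator_def)
    qed (use \<epsilon> in auto)
    moreover have "0 \<le> (\<Sum>j<k. \<epsilon> * indicator {0..<measure half_line (B S j)} x)"
      using \<epsilon> by (intro sum_nonneg) auto
    ultimately show "cmod (Q S x) \<le> cmod (Q T x)"
      unfolding Q_def norm_of_real by linarith
  qed
  also have "N (Q T) = N (P T)" by (simp add: PQ[OF T])
  also have "N (P T) \<le> N (\<lambda>x. complex_of_real (cmod (T x)) + of_real \<epsilon> * ?X x)"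
  proof (rule N_mono[OF PJ[OF T]])
    show "(\<lambda>x. complex_of_real (cmod (T x)) + of_real \<epsilon> * ?X x) \<in> J"
      using J_measurable[OF T]
      by (intro J_add J_scale X J_dominated[OF T, where c = 1]) auto
    show "AE x in half_line. cmod (P T x) \<le> cmod (complex_of_real (cmod (T x)) + of_real \<epsilon> * ?X x)"
      using D pos
    proof eventually_elim
      case (elim x)
      have "(\<Sum>j<k. \<epsilon> * indicator {y. real j * \<epsilon> < y} (cmod (T x)))
          \<le> cmod (T x) + \<epsilon> * indicator {0<..} (cmod (T x))"
        using \<epsilon> elim k by (intro sum_layers) auto
      moreover have "0 \<le> (\<Sum>j<k. \<epsilon> * indicator {y. real j * \<epsilon> < y} (cmod (T x)))"
        using \<epsilon> by (intro sum_nonneg) auto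
      moreover have eq: "complex_of_real (cmod (T x)) + of_real \<epsilon> * ?X x
          = complex_of_real (cmod (T x) + \<epsilon> * indicator {0<..} (cmod (T x)))"
        using elim by (auto simp: indicator_def)
      ultimately show ?case unfolding P_eq[OF elim(2)] eq norm_of_real by linarith
    qed
  qed
  also have "\<dots> \<le> N T + \<epsilon> * N ?X"
  proof -
    have "(\<lambda>x. complex_of_real (cmod (T x))) \<in> J"
      using J_measurable[OF T] by (intro J_dominated[OF T, where c = 1]) auto
    from N_triangle[OF this J_scale[OF X, of "of_real \<epsilon>"]] show ?thesis
      using N_scale[OF X, of "of_real \<epsilon>"] N_abs[OF T] \<epsilon> by simp
  qed
  finally show "N S \<le> N T + \<epsilon> * N ?X" .
qed

end

section \<open>Averaging over intervals\<close>

text \<open>The cone of test functions: it contains every rearrangement and is closed under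
  averaging over an interval. The value at \<open>0\<close> is a bound.\<close>

definition profile :: "(real \<Rightarrow> real) set" where
  "profile = {S. (\<forall>x<0. S x = 0) \<and> antimono_on {0..} S \<and> (\<forall>x\<ge>0. 0 \<le> S x) \<and> (\<exists>L. \<forall>x\<ge>L. S x = 0)}"

lemma profile_antimono: "S \<in> profile \<Longrightarrow> 0 \<le> x \<Longrightarrow> x \<le> y \<Longrightarrow> S y \<le> S x"
  using monotone_onD[of "{0..}" "(\<le>)" "(\<ge>)" S x y] by (auto simp: profile_def)

lemma profile_nonneg: "S \<in> profile \<Longrightarrow> 0 \<le> S x"
  unfolding profile_def by (cases "x < 0") auto

lemma profile_neg: "S \<in> profile \<Longrightarrow> x < 0 \<Longrightarrow> S x = 0"
  unfolding profile_def by auto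

lemma profile_bounded: "S \<in> profile \<Longrightarrow> S x \<le> S 0"
  using profile_antimono[of S 0 x] profile_neg[of S x] profile_nonneg[of S 0] by (cases "x < 0") auto

lemma profile_support:
  assumes "S \<in> profile"
  obtains L where "0 < L" "\<And>x. x \<notin> {0..<L} \<Longrightarrow> S x = 0"
proof -
  from assms obtain L where "\<And>x. x \<ge> L \<Longrightarrow> S x = 0" "\<And>x. x < 0 \<Longrightarrow> S x = 0"
    unfolding profile_def by blast
  then show thesis by (intro that[of "max L 1"]) auto
qed

lemma profile_measurable:
  assumes "S \<in> profile" shows "S \<in> borel_measurable borel"
proof -
  have "mono (\<lambda>x. - S (max x 0))"
    by (intro monoI le_imp_neg_le profile_antimono[OF assms]) auto
  from borel_measurable_uminus[OF borel_measurable_mono[OF this]]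
  have [measurable]: "(\<lambda>x. S (max x 0)) \<in> borel_measurable borel" by simp
  have "(\<lambda>x. if x < 0 then 0 else S (max x 0)) \<in> borel_measurable borel"
    by measurable
  also have "(\<lambda>x. if x < 0 then 0 else S (max x 0)) = S"
    using profile_neg[OF assms] by (auto simp: max_def)
  finally show ?thesis .
qed

lemma emeasure_lborel_Ico_finite: "emeasure lborel {a..<b::real} < \<infinity>"
  by (rule emeasure_bounded_finite[OF bounded_subset[OF bounded_closed_interval[of a b]]]) auto

lemma integrable_bounded_support:
  fixes f :: "real \<Rightarrow> real"
  assumes [measurable]: "f \<in> borel_measurable borel"
    and "\<And>x. \<bar>f x\<bar> \<le> C" "\<And>x. x \<notin> {a..<b} \<Longrightarrow> f x = 0"
  shows "integrable lborel f"
proof (rule Bochner_Integration.integrable_bound)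
  show "integrable lborel (\<lambda>x. C * indicator {a..<b} x :: real)"
    by (intro integrable_mult_right integrable_real_indicator emeasure_lborel_Ico_finite) simp
  have "\<bar>f x\<bar> \<le> \<bar>C * indicator {a..<b} x\<bar>" for x
    using assms(2)[of x] assms(3)[of x] by (cases "x \<in> {a..<b}") auto
  then show "AE x in lborel. norm (f x) \<le> norm (C * indicator {a..<b} x :: real)" by simp
qed simp

lemma profile_integrable_mult:
  assumes S: "S \<in> profile" and [measurable]: "f \<in> borel_measurable borel" and f: "\<And>x. \<bar>f x\<bar> \<le> C"
  shows "integrable lborel (\<lambda>x. f x * S x)"
proof -
  obtain L where L: "0 < L" "\<And>x. x \<notin> {0..<L} \<Longrightarrow> S x = 0"
    using profile_support[OF S] by blast
  have [measurable]: "S \<in> borel_measurable borel" by (rule profile_measurable[OF S])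
  have "\<bar>f x * S x\<bar> \<le> C * S 0" for x
    unfolding abs_mult
    using f[of x] profile_bounded[OF S, of x] profile_nonneg[OF S]
    by (intro mult_mono) (auto intro: order_trans[OF abs_ge_zero])
  then show ?thesis
    by (intro integrable_bounded_support[where a = 0 and b = L and C = "C * S 0"]) (auto simp: L)
qed

lemma bounded_support_J:
  assumes [measurable]: "f \<in> borel_measurable borel"
    and "\<And>x. 0 \<le> x \<Longrightarrow> \<bar>f x\<bar> \<le> C" "\<And>x. L \<le> x \<Longrightarrow> f x = 0"
  shows "(\<lambda>x. complex_of_real (f x)) \<in> J"
proof (rule J_dominated[where c = C])
  show "(\<lambda>x. complex_of_real (indicator {0..<max L 0} x)) \<in> J"
    by (intro J_indicator) (auto simp: half_line_sets_iff)
  show "(\<lambda>x. complex_of_real (f x)) \<in> borel_measurable half_line"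
    by (intro borel_measurable_half_lineI) measurable
  show "AE x in half_line. cmod (complex_of_real (f x)) \<le> C * cmod (complex_of_real (indicator {0..<max L 0} x))"
    using assms(2,3) by (auto simp: AE_half_line_iff indicator_def)
qed

lemma profile_J:
  assumes S: "S \<in> profile" shows "(\<lambda>x. complex_of_real (S x)) \<in> J"
proof -
  obtain L where L: "0 < L" "\<And>x. x \<notin> {0..<L} \<Longrightarrow> S x = 0"
    using profile_support[OF S] by blast
  show ?thesis
    by (rule bounded_support_J[where C = "S 0" and L = L])
      (use L(2) profile_bounded[OF S] profile_nonneg[OF S] profile_measurable[OF S] in auto)
qed

definition avg :: "real \<Rightarrow> real \<Rightarrow> (real \<Rightarrow> real) \<Rightarrow> real" where
  "avg p q S = (\<integral>x. indicator {p..<q} x * S x \<partial>lborel) / (q - p)"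

definition averaged :: "real \<Rightarrow> real \<Rightarrow> (real \<Rightarrow> real) \<Rightarrow> real \<Rightarrow> real" where
  "averaged p q S x = (if p \<le> x \<and> x < q then avg p q S else S x)"

lemma avg_le_iff:
  "p < q \<Longrightarrow> avg p q S \<le> m \<longleftrightarrow> (\<integral>x. indicator {p..<q} x * S x \<partial>lborel) \<le> m * (q - p)"
  "p < q \<Longrightarrow> m \<le> avg p q S \<longleftrightarrow> m * (q - p) \<le> (\<integral>x. indicator {p..<q} x * S x \<partial>lborel)"
  by (simp_all add: avg_def pos_divide_le_eq pos_le_divide_eq)

lemma profile_integrable_Ico: "S \<in> profile \<Longrightarrow> integrable lborel (\<lambda>x. indicator {p..<q} x * S x)"
  by (rule profile_integrable_mult[where C = 1]) (auto simp: indicator_def)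

lemma integrable_Ico:
  fixes p q c :: real
  shows "integrable lborel (\<lambda>x. indicator {p..<q} x * c)"
  by (intro integrable_mult_left integrable_real_indicator emeasure_lborel_Ico_finite) simp

lemma profile_avg_bounds:
  assumes S: "S \<in> profile" and pq: "0 \<le> p" "p < q"
  shows "S q \<le> avg p q S" "avg p q S \<le> S p"
proof -
  have "(\<integral>x. indicator {p..<q} x * S q \<partial>lborel) \<le> (\<integral>x. indicator {p..<q} x * S x \<partial>lborel)"
    using pq by (intro integral_mono profile_integrable_Ico[OF S] integrable_Ico)
      (auto simp: indicator_def intro: profile_antimono[OF S])
  moreover have "(\<integral>x. indicator {p..<q} x * S x \<partial>lborel) \<le> (\<integral>x. indicator {p..<q} x * S p \<partial>lborel)"
    using pq by (intro integral_mono profile_integrable_Ico[OF S] integrable_Ico)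
      (auto simp: indicator_def intro: profile_antimono[OF S])
  ultimately show "S q \<le> avg p q S" "avg p q S \<le> S p"
    using pq by (simp_all add: avg_le_iff mult.commute)
qed

text \<open>The mean lies between \<open>S q\<close> and \<open>S p\<close>, so no upward jump
  arises at either end.\<close>

lemma averaged_profile:
  assumes S: "S \<in> profile" and pq: "0 \<le> p" "p < q"
  shows "averaged p q S \<in> profile"
proof -
  obtain L where L: "0 < L" "\<And>x. x \<notin> {0..<L} \<Longrightarrow> S x = 0"
    using profile_support[OF S] by blast
  note b = profile_avg_bounds[OF S pq]
  have "antimono_on {0..} (averaged p q S)"
  proof (rule monotone_onI)
    fix x y :: real assume xy: "x \<in> {0..}" "y \<in> {0..}" "x \<le> y"
    then have "S y \<le> S x" "p \<le> y \<Longrightarrow> x \<le> p \<Longrightarrow> S p \<le> S x" "q \<le> y \<Longrightarrow> S y \<le> S q" "x < p \<Longrightarrow> S p \<le> S x"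
      using pq by (auto intro!: profile_antimono[OF S])
    then show "averaged p q S y \<le> averaged p q S x"
      using xy b unfolding averaged_def by auto
  qed
  moreover have "averaged p q S x = 0" if "x < 0" for x
    using that pq profile_neg[OF S] by (auto simp: averaged_def)
  moreover have "averaged p q S x = 0" if "max L q \<le> x" for x
    using that pq L(2) by (auto simp: averaged_def)
  moreover have "0 \<le> averaged p q S x" for x
    using order_trans[OF profile_nonneg[OF S] b(1)] profile_nonneg[OF S] by (auto simp: averaged_def)
  ultimately show ?thesis unfolding profile_def by blast
qed

text \<open>Used in two ways: for a fixed shift it permutes the cells, and for a fixed cell it lets
  the shifts run through all values.\<close>

lemma bij_betw_cyclic_shift:
  fixes k j :: nat
  shows "bij_betw (\<lambda>i. (i + j) mod k) {..<k} {..<k}"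
proof (cases "k = 0")
  case False
  have "inj_on (\<lambda>i. (i + j) mod k) {..<k}"
  proof (rule inj_onI)
    fix a b assume ab: "a \<in> {..<k}" "b \<in> {..<k}" "(a + j) mod k = (b + j) mod k"
    then have "int (a + j) mod int k = int (b + j) mod int k" by (metis of_nat_mod)
    then have "int k dvd int a - int b" by (simp add: mod_eq_dvd_iff)
    moreover have "\<bar>int a - int b\<bar> < int k" using ab by auto
    ultimately show "a = b" using dvd_imp_le_int[of "int a - int b" "int k"] by (cases "a = b") auto
  qed
  moreover from this have "(\<lambda>i. (i + j) mod k) ` {..<k} = {..<k}"
    using False by (intro endo_inj_surj) auto
  ultimately show ?thesis by (simp add: bij_betw_def)
qed (simp add: bij_betw_def)

context symmetric_gauge
begin

lemma N_real_mono:
  assumes "(\<lambda>x. complex_of_real (S x)) \<in> J" "(\<lambda>x. complex_of_real (T x)) \<in> J"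
    and "\<And>x. 0 \<le> x \<Longrightarrow> 0 \<le> S x \<and> S x \<le> T x"
  shows "N (\<lambda>x. complex_of_real (S x)) \<le> N (\<lambda>x. complex_of_real (T x))"
proof (rule N_mono[OF assms(1,2)])
  show "AE x in half_line. cmod (complex_of_real (S x)) \<le> cmod (complex_of_real (T x))"
    unfolding AE_half_line_iff
  proof (rule AE_I2, rule impI)
    fix x :: real assume "0 \<le> x"
    then show "cmod (complex_of_real (S x)) \<le> cmod (complex_of_real (T x))"
      using assms(3)[of x] by simp
  qed
qed

text \<open>\<open>R j\<close> carries the cell values of \<open>S\<close> shifted cyclically by
  \<open>j\<close>. Its norm is that of \<open>R 0\<close>, which is at most that of
  \<open>S\<close>, and the mean of the \<open>R j\<close> is the constant \<open>W\<close> on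
  \<open>{p..<q}\<close>. \<open>W\<close> misses the true average by at most
  \<open>S p / k\<close>, and \<open>k\<close> is arbitrary.\<close>

lemma N_averaged_le:
  assumes S: "S \<in> profile" and pq: "0 \<le> p" "p < q"
  shows "N (\<lambda>x. complex_of_real (averaged p q S x)) \<le> N (\<lambda>x. complex_of_real (S x))"
proof -
  let ?X = "\<lambda>x. complex_of_real (indicator {p..<q} x)"
  have X: "?X \<in> J" using pq by (intro J_indicator) (auto simp: half_line_sets_iff emeasure_half_line_Ico)
  obtain L where L: "0 < L" "\<And>x. x \<notin> {0..<L} \<Longrightarrow> S x = 0"
    using profile_support[OF S] by blast
  have [measurable]: "S \<in> borel_measurable borel" by (rule profile_measurable[OF S])
  have "N (\<lambda>x. complex_of_real (averaged p q S x)) \<le> N (\<lambda>x. complex_of_real (S x)) + (S p * N ?X) / real (Suc n)"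
    for n
  proof -
    define k where "k = Suc n"
    define d where "d = (q - p) / real k"
    have d: "0 < d" "real k * d = q - p" using pq by (simp_all add: d_def k_def)
    define C where "C i = {p + real i * d..<p + (real i + 1) * d}" for i :: nat
    define cell where "cell x = nat \<lfloor>(x - p) / d\<rfloor>" for x
    \<comment> \<open>The value at the right end of a cell, hence a lower one: this gives
      \<open>R 0 \<le> S\<close>.\<close>
    define w where "w i = S (p + (real i + 1) * d)" for i :: nat
    define R where "R j x = (if p \<le> x \<and> x < q then w ((cell x + j) mod k) else S x)" for j x
    have cell: "cell x < k" "x \<in> C (cell x)" if "p \<le> x" "x < q" for x
    proof -
      have ge: "0 \<le> (x - p) / d" using that d by simp
      then have "real (cell x) \<le> (x - p) / d" "(x - p) / d < real (cell x) + 1"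
        unfolding cell_def by (simp_all add: floor_less_iff[symmetric])
      then have *: "real (cell x) * d \<le> x - p" "x - p < (real (cell x) + 1) * d"
        using d by (simp_all add: pos_le_divide_eq pos_divide_less_eq)
      then show "x \<in> C (cell x)" by (auto simp: C_def)
      have "real (cell x) * d < real k * d" using * that d by linarith
      then show "cell x < k" using d(1) by simp
    qed
    have cellI: "p \<le> x \<and> x < q \<and> cell x = i" if "x \<in> C i" "i < k" for x i
    proof -
      have x: "real i * d \<le> x - p" "x - p < (real i + 1) * d" using that by (auto simp: C_def)
      have "(real i + 1) * d \<le> real k * d" using that(2) d(1) by (intro mult_right_mono) auto
      moreover have "0 \<le> real i * d" using d(1) by simp
      moreover have "\<lfloor>(x - p) / d\<rfloor> = int i"
        using x d(1) by (intro floor_unique) (simp_all add: pos_le_divide_eq pos_divide_less_eq)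
      ultimately show ?thesis using x d(2) unfolding cell_def by auto
    qed
    have w: "0 \<le> w i" "w i \<le> S 0" for i
      using profile_nonneg[OF S] profile_bounded[OF S] by (auto simp: w_def)
    have R_meas: "R j \<in> borel_measurable borel" for j
      unfolding R_def cell_def by measurable
    have RJ: "(\<lambda>x. complex_of_real (R j x)) \<in> J" for j
      by (rule bounded_support_J[OF R_meas, where C = "S 0" and L = "max L q"])
        (use w L(2) profile_nonneg[OF S] profile_bounded[OF S] in \<open>auto simp: R_def\<close>)
    have R0_le: "N (\<lambda>x. complex_of_real (R 0 x)) \<le> N (\<lambda>x. complex_of_real (S x))"
    proof (rule N_real_mono[OF RJ profile_J[OF S]])
      fix x :: real assume "0 \<le> x"
      show "0 \<le> R 0 x \<and> R 0 x \<le> S x"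
      proof (cases "p \<le> x \<and> x < q")
        case True
        then have "R 0 x = S (p + (real (cell x) + 1) * d)" using cell[of x] by (simp add: R_def w_def)
        also have "\<dots> \<le> S x" using cell[of x] True \<open>0 \<le> x\<close> by (intro profile_antimono[OF S]) (auto simp: C_def)
        finally show ?thesis using True w by (simp add: R_def)
      qed (auto simp: R_def profile_nonneg[OF S])
    qed
    \<comment> \<open>The right-hand side is free of \<open>j\<close>, so all shifts are
      equidistributed.\<close>
    have distr: "emeasure half_line {x. 0 \<le> x \<and> y < cmod (complex_of_real (R j x))}
        = emeasure half_line ({x. 0 \<le> x \<and> y < S x} - {p..<q}) + of_nat (card {i. i < k \<and> y < w i}) * ennreal d"
      for y j
    proof -
      let ?I = "{i. i < k \<and> y < w ((i + j) mod k)}"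
      have R0: "R j x \<ge> 0" for x using w profile_nonneg[OF S] by (simp add: R_def)
      have cells: "x \<in> (\<Union>i\<in>?I. C i) \<longleftrightarrow> p \<le> x \<and> x < q \<and> y < w ((cell x + j) mod k)" for x
        using cell[of x] cellI[of x] by blast
      have eq: "{x. 0 \<le> x \<and> y < cmod (complex_of_real (R j x))} = ({x. 0 \<le> x \<and> y < S x} - {p..<q}) \<union> (\<Union>i\<in>?I. C i)"
      proof (rule set_eqI)
        fix x
        show "x \<in> {x. 0 \<le> x \<and> y < cmod (complex_of_real (R j x))}
          \<longleftrightarrow> x \<in> ({x. 0 \<le> x \<and> y < S x} - {p..<q}) \<union> (\<Union>i\<in>?I. C i)"
          unfolding Un_iff cells using R0[of x] pq by (auto simp: R_def)
      qed
      have disj: "({x. 0 \<le> x \<and> y < S x} - {p..<q}) \<inter> (\<Union>i\<in>?I. C i) = {}"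
        unfolding disjoint_iff cells by auto
      have C_nonneg: "0 \<le> real i * d" for i using d(1) by simp
      then have Csets: "C i \<in> sets half_line" for i
        using order_trans[OF add_nonneg_nonneg[OF pq(1) C_nonneg[of i]]] by (auto simp: C_def half_line_sets_iff)
      have S_sets: "{x. 0 \<le> x \<and> y < S x} - {p..<q} \<in> sets half_line"
      proof -
        have "{x \<in> space borel. 0 \<le> x \<and> y < S x} - {p..<q} \<in> sets borel" by measurable
        then show ?thesis by (auto simp: half_line_sets_iff)
      qed
      have C_sets: "(\<Union>i\<in>?I. C i) \<in> sets half_line" using Csets by (intro sets.finite_UN) auto
      have "emeasure half_line {x. 0 \<le> x \<and> y < cmod (complex_of_real (R j x))}
        = emeasure half_line ({x. 0 \<le> x \<and> y < S x} - {p..<q}) + emeasure half_line (\<Union>i\<in>?I. C i)"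
        unfolding eq by (rule plus_emeasure[OF S_sets C_sets disj, symmetric])
      also have "emeasure half_line (\<Union>i\<in>?I. C i) = (\<Sum>i\<in>?I. emeasure half_line (C i))"
      proof (rule sum_emeasure[symmetric])
        show "disjoint_family_on C ?I"
          unfolding disjoint_family_on_def using cellI by (auto simp: disjoint_iff)
      qed (use Csets in auto)
      also have "\<dots> = (\<Sum>i\<in>?I. ennreal d)"
        using pq d(1) C_nonneg by (intro sum.cong refl) (simp add: C_def emeasure_half_line_Ico algebra_simps)
      also have "\<dots> = of_nat (card ?I) * ennreal d" by simp
      also have "card ?I = card {i. i < k \<and> y < w i}"
      proof -
        have "(\<Sum>i<k. if y < w ((i + j) mod k) then 1 else 0 :: nat) = (\<Sum>i<k. if y < w i then 1 else 0)"
          by (rule sum.reindex_bij_betw[OF bij_betw_cyclic_shift])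
        then show ?thesis by (simp add: sum.If_cases Int_def)
      qed
      finally show ?thesis .
    qed
    have R_le: "N (\<lambda>x. complex_of_real (R j x)) \<le> N (\<lambda>x. complex_of_real (S x))" for j
      by (rule order_trans[OF N_le_of_distribution_le[OF RJ RJ] R0_le]) (simp only: measure_def distr order_refl)
    define W where "W = (\<Sum>i<k. w i) / real k"
    have sumR: "(\<Sum>j<k. R j x) / real k = (if p \<le> x \<and> x < q then W else S x)" for x
    proof (cases "p \<le> x \<and> x < q")
      case True
      have "(\<Sum>j<k. R j x) = (\<Sum>j<k. w ((j + cell x) mod k))"
        using True by (simp add: R_def add.commute)
      also have "\<dots> = (\<Sum>i<k. w i)" by (rule sum.reindex_bij_betw[OF bij_betw_cyclic_shift])
      finally show ?thesis using True by (simp add: W_def)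
    next
      case False
      then have "R j x = S x" for j by (auto simp: R_def)
      moreover have "0 < k" by (simp add: k_def)
      ultimately show ?thesis unfolding if_not_P[OF False] by simp
    qed
    \<comment> \<open>The left-end values of the cells are \<open>S p, w 0, ..., w (k - 2)\<close>,
      so the upper Riemann sum exceeds the lower one by at most \<open>d * S p\<close>.\<close>
    have avg_le: "avg p q S \<le> W + S p / real k"
    proof -
      have "(\<integral>x. indicator {p..<q} x * S x \<partial>lborel) \<le> (\<integral>x. (\<Sum>i<k. indicator (C i) x * S (p + real i * d)) \<partial>lborel)"
      proof (rule integral_mono)
        show "integrable lborel (\<lambda>x. indicator {p..<q} x * S x)" by (rule profile_integrable_Ico[OF S])
        show "integrable lborel (\<lambda>x. \<Sum>i<k. indicator (C i) x * S (p + real i * d))"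
          unfolding C_def by (intro Bochner_Integration.integrable_sum integrable_Ico)
        fix x :: real
        show "indicator {p..<q} x * S x \<le> (\<Sum>i<k. indicator (C i) x * S (p + real i * d))"
        proof (cases "p \<le> x \<and> x < q")
          case True
          have "S x \<le> S (p + real (cell x) * d)"
            using cell[of x] True pq d by (intro profile_antimono[OF S]) (auto simp: C_def)
          also have "\<dots> = indicator (C (cell x)) x * S (p + real (cell x) * d)" using cell[of x] True by simp
          also have "\<dots> \<le> (\<Sum>i<k. indicator (C i) x * S (p + real i * d))"
            using cell[of x] True profile_nonneg[OF S] by (intro member_le_sum) auto
          finally show ?thesis using True by simp
        qed (auto intro!: sum_nonneg simp: profile_nonneg[OF S])
      qed
      also have "\<dots> = (\<Sum>i<k. d * S (p + real i * d))"
      proof (subst Bochner_Integration.integral_sum)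
        show "integrable lborel (\<lambda>x. indicator (C i) x * S (p + real i * d))" for i
          unfolding C_def by (rule integrable_Ico)
        have "(\<integral>x. indicator (C i) x * S (p + real i * d) \<partial>lborel) = d * S (p + real i * d)" for i
          using d by (simp add: C_def algebra_simps)
        then show "(\<Sum>i<k. \<integral>x. indicator (C i) x * S (p + real i * d) \<partial>lborel) = (\<Sum>i<k. d * S (p + real i * d))"
          by (intro sum.cong refl)
      qed
      also have "\<dots> = d * (S p + (\<Sum>i<n. w i))"
        unfolding k_def sum.lessThan_Suc_shift
        by (simp add: w_def sum_distrib_left distrib_left algebra_simps)
      also have "\<dots> \<le> d * (S p + (\<Sum>i<k. w i))"
        using w d by (intro mult_left_mono add_left_mono) (auto simp: k_def)
      also have "\<dots> = (W + S p / real k) * (q - p)"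
      proof -
        have "real k \<noteq> 0" by (simp add: k_def)
        then show ?thesis unfolding W_def d(2)[symmetric] by (simp add: field_simps)
      qed
      finally show ?thesis using pq by (simp add: avg_le_iff)
    qed
    define V where "V x = (if p \<le> x \<and> x < q then W else S x)" for x
    have V_eq: "(\<lambda>x. complex_of_real (V x)) = (\<lambda>x. complex_of_real (1 / real k) * (\<Sum>j<k. complex_of_real (R j x)))"
    proof
      fix x show "complex_of_real (V x) = complex_of_real (1 / real k) * (\<Sum>j<k. complex_of_real (R j x))"
        using arg_cong[OF sumR[of x], of complex_of_real] by (simp add: V_def)
    qed
    have VJ: "(\<lambda>x. complex_of_real (V x)) \<in> J"
      unfolding V_eq by (intro J_scale J_sum RJ) simp
    have "N (\<lambda>x. complex_of_real (V x)) = 1 / real k * N (\<lambda>x. \<Sum>j<k. complex_of_real (R j x))"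
      unfolding V_eq by (subst N_scale) (auto intro!: J_sum RJ simp: norm_divide)
    also have "\<dots> \<le> 1 / real k * (\<Sum>j<k. N (\<lambda>x. complex_of_real (R j x)))"
      by (intro mult_left_mono N_sum RJ) auto
    also have "\<dots> \<le> 1 / real k * (\<Sum>j<k. N (\<lambda>x. complex_of_real (S x)))"
      by (intro mult_left_mono sum_mono R_le) auto
    also have "\<dots> = N (\<lambda>x. complex_of_real (S x))" by (simp add: k_def)
    finally have NV: "N (\<lambda>x. complex_of_real (V x)) \<le> N (\<lambda>x. complex_of_real (S x))" .
    have VX: "(\<lambda>x. complex_of_real (V x + S p / real k * indicator {p..<q} x)) \<in> J"
      using J_add[OF VJ J_scale[OF X, of "complex_of_real (S p / real k)"]] by simp
    have "N (\<lambda>x. complex_of_real (averaged p q S x)) \<le> N (\<lambda>x. complex_of_real (V x + S p / real k * indicator {p..<q} x))"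
      using avg_le profile_nonneg[OF averaged_profile[OF S pq]]
      by (intro N_real_mono[OF profile_J[OF averaged_profile[OF S pq]] VX]) (auto simp: averaged_def V_def)
    also have "\<dots> \<le> N (\<lambda>x. complex_of_real (V x)) + S p / real k * N ?X"
      using N_triangle[OF VJ J_scale[OF X, of "complex_of_real (S p / real k)"]]
        N_scale[OF X, of "complex_of_real (S p / real k)"] profile_nonneg[OF S, of p]
      by (simp add: norm_divide)
    finally show ?thesis using NV by (simp add: k_def)
  qed
  moreover have "(\<lambda>n. N (\<lambda>x. complex_of_real (S x)) + (S p * N ?X) / real (Suc n)) \<longlonglongrightarrow> N (\<lambda>x. complex_of_real (S x)) + 0"
    by (intro tendsto_add tendsto_const LIMSEQ_Suc[OF lim_const_over_n])
  ultimately show ?thesis by (intro LIMSEQ_le_const) auto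
qed

end

section \<open>Step functions and pooling\<close>

text \<open>The half-open \<open>{x<..y}\<close> means that at a point of \<open>P\<close> the new
  value is already taken, so \<open>f\<close> is right continuous on the half line. \<open>P\<close>
  may list points without a jump; its cardinality is what decreases under pooling.\<close>

definition step_on :: "real set \<Rightarrow> (real \<Rightarrow> real) \<Rightarrow> bool" where
  "step_on P f \<longleftrightarrow> finite P \<and> f \<in> borel_measurable borel \<and> (\<forall>x<0. f x = 0) \<and> (\<forall>x. 0 \<le> f x) \<and>
     (\<forall>x y. 0 \<le> x \<longrightarrow> x \<le> y \<longrightarrow> P \<inter> {x<..y} = {} \<longrightarrow> f x = f y) \<and> (\<exists>L. \<forall>x\<ge>L. f x = 0)"

lemma step_on_const:
  assumes "step_on P f" "0 \<le> x" "x \<le> y" "\<And>r. r \<in> P \<Longrightarrow> x < r \<Longrightarrow> r \<le> y \<Longrightarrow> False"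
  shows "f x = f y"
proof -
  have "P \<inter> {x<..y} = {}" using assms(4) by force
  then show ?thesis using assms(1-3) unfolding step_on_def by blast
qed

text \<open>On the half line each value is attained at the last breakpoint before the argument, or
  at \<open>0\<close>.\<close>

lemma step_on_range: "step_on P f \<Longrightarrow> f ` UNIV \<subseteq> insert 0 (f ` insert 0 P)"
proof
  fix y assume f: "step_on P f" and "y \<in> f ` UNIV"
  then obtain x where y: "y = f x" by auto
  show "y \<in> insert 0 (f ` insert 0 P)"
  proof (cases "x < 0")
    case False
    let ?M = "insert 0 (P \<inter> {..x})"
    have fin: "finite ?M" using f by (simp add: step_on_def)
    have "Max ?M \<in> ?M" using fin by (intro Max_in) auto
    then have "Max ?M \<in> insert 0 P" by blast
    then have "f (Max ?M) \<in> f ` insert 0 P" by (rule imageI)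
    moreover have "f (Max ?M) = f x"
    proof (rule step_on_const[OF f])
      show "0 \<le> Max ?M" using fin by (intro Max_ge) auto
      show "Max ?M \<le> x" using False fin by (subst Max_le_iff) auto
      fix r assume "r \<in> P" "Max ?M < r" "r \<le> x"
      then show False using Max_ge[OF fin, of r] by auto
    qed
    ultimately show ?thesis using y by simp
  qed (use f y in \<open>simp add: step_on_def\<close>)
qed

lemma step_on_finite_range: "step_on P f \<Longrightarrow> finite (f ` A)"
  by (rule finite_subset[OF order_trans[OF image_mono[OF subset_UNIV] step_on_range]])
    (auto simp: step_on_def)

lemma step_on_bounded:
  assumes "step_on P f" obtains C where "\<And>x. \<bar>f x\<bar> \<le> C"
proof (rule that)
  fix x show "\<bar>f x\<bar> \<le> Max (abs ` range f)"
    using step_on_finite_range[OF assms, of UNIV] by (intro Max_ge) auto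
qed

text \<open>Among the points \<open>y\<close> with a smaller value somewhere before, take one with
  fewest breakpoints up to it. Let \<open>r\<close> be the last breakpoint up to \<open>y\<close>
  and \<open>p\<close> the one preceding it, or \<open>0\<close>. By minimality nothing before
  \<open>p\<close> lies below \<open>f p\<close>, so the rise happens exactly at
  \<open>r\<close>.\<close>

lemma step_on_upward_jump:
  assumes f: "step_on P f" and not_mono: "\<not> antimono_on {0..} f"
  obtains p r q where "0 \<le> p" "p < r" "r < q" "r \<in> P" "p = 0 \<or> p \<in> P" "q \<in> P"
    "P \<inter> {p<..<r} = {}" "P \<inter> {r<..<q} = {}" "f p < f r"
proof -
  have fin: "finite P" using f by (simp add: step_on_def)
  have "\<exists>y. \<exists>x. 0 \<le> x \<and> x \<le> y \<and> f x < f y"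
    using not_mono by (auto simp: monotone_on_def not_le)
  then obtain y where y: "\<exists>x. 0 \<le> x \<and> x \<le> y \<and> f x < f y"
    and min: "\<And>z. card (P \<inter> {..z}) < card (P \<inter> {..y}) \<Longrightarrow> \<not> (\<exists>x. 0 \<le> x \<and> x \<le> z \<and> f x < f z)"
    using ex_has_least_nat[of "\<lambda>y. \<exists>x. 0 \<le> x \<and> x \<le> y \<and> f x < f y" _ "\<lambda>y. card (P \<inter> {..y})"]
    by (metis not_le)
  from y obtain x where x: "0 \<le> x" "x \<le> y" "f x < f y" by blast
  have ne: "P \<inter> {x<..y} \<noteq> {}" using step_on_const[OF f x(1,2)] x(3) by (auto simp: disjoint_iff)
  define r where "r = Max (P \<inter> {x<..y})"
  have r: "r \<in> P" "x < r" "r \<le> y" using Max_in[of "P \<inter> {x<..y}"] ne fin by (auto simp: r_def)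
  have r_max: "s \<le> r" if "s \<in> P" "s \<le> y" for s
    using that fin r by (cases "x < s") (auto simp: r_def intro!: Max_ge)
  have fr: "f r = f y" by (rule step_on_const[OF f]) (use r x r_max in \<open>auto simp: not_le[symmetric]\<close>)
  let ?M = "insert 0 (P \<inter> {..<r})"
  define p where "p = Max ?M"
  have p: "p = 0 \<or> p \<in> P" "p < r" "0 \<le> p"
    using Max_in[of ?M] fin r x Max_ge[of ?M 0] by (auto simp: p_def)
  have p_max: "s \<le> p" if "s \<in> P" "s < r" for s
    using that fin by (auto simp: p_def intro!: Max_ge)
  have "f p < f r"
  proof (cases "x \<le> p")
    case True
    have "r \<in> P \<inter> {..y}" "r \<notin> P \<inter> {..p}" "P \<inter> {..p} \<subseteq> P \<inter> {..y}" using r p by auto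
    then have "P \<inter> {..p} \<subset> P \<inter> {..y}" by blast
    then have "card (P \<inter> {..p}) < card (P \<inter> {..y})" using fin by (intro psubset_card_mono) auto
    then have "\<not> f x < f p" using min True x(1) by blast
    then show ?thesis using fr x by linarith
  next
    case False
    have "f p = f x" by (rule step_on_const[OF f p(3)]) (use False r p_max in force)+
    then show ?thesis using fr x by simp
  qed
  \<comment> \<open>A further breakpoint exists because \<open>f\<close> must return from the
    positive value \<open>f r\<close> to \<open>0\<close>.\<close>
  moreover have "P \<inter> {r<..} \<noteq> {}"
  proof
    assume *: "P \<inter> {r<..} = {}"
    obtain L where "\<And>x. L \<le> x \<Longrightarrow> f x = 0" using f by (auto simp: step_on_def)
    moreover have "f r = f (max r L)" by (rule step_on_const[OF f]) (use * x r in auto)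
    ultimately have "f r = 0" by simp
    moreover have "0 \<le> f p" using f by (simp add: step_on_def)
    ultimately show False using \<open>f p < f r\<close> by simp
  qed
  then have q: "Min (P \<inter> {r<..}) \<in> P" "r < Min (P \<inter> {r<..})"
    using Min_in[of "P \<inter> {r<..}"] fin by auto
  moreover have "P \<inter> {r<..<Min (P \<inter> {r<..})} = {}"
    using fin by (auto simp: disjoint_iff not_less intro!: Min_le)
  moreover have "P \<inter> {p<..<r} = {}" using p_max by force
  ultimately show thesis using p r by (intro that[of p r "Min (P \<inter> {r<..})"]) auto
qed

text \<open>Averaging is self-adjoint: the first two integrals have the same right-hand
  side.\<close>

lemma integral_averaged_split:
  assumes S: "S \<in> profile" and f: "step_on P f" and pq: "0 \<le> p" "p < q"
  shows "(\<integral>x. averaged p q f x * S x \<partial>lborel)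
      = avg p q f * avg p q S * (q - p) + (\<integral>x. (1 - indicator {p..<q} x) * f x * S x \<partial>lborel)"
    and "(\<integral>x. f x * averaged p q S x \<partial>lborel)
      = avg p q f * avg p q S * (q - p) + (\<integral>x. (1 - indicator {p..<q} x) * f x * S x \<partial>lborel)"
    and "(\<integral>x. f x * S x \<partial>lborel) = (\<integral>x. indicator {p..<q} x * (f x * S x) \<partial>lborel)
        + (\<integral>x. (1 - indicator {p..<q} x) * f x * S x \<partial>lborel)"
proof -
  obtain C where C: "\<And>x. \<bar>f x\<bar> \<le> C" using step_on_bounded[OF f] by blast
  have [measurable]: "f \<in> borel_measurable borel" using f by (simp add: step_on_def)
  have bd: "\<bar>(1 - indicator {p..<q} x) * f x\<bar> \<le> C" "\<bar>indicator {p..<q} x * f x\<bar> \<le> C" for x :: real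
    using C[of x] by (auto simp: indicator_def)
  have i1: "integrable lborel (\<lambda>x. (1 - indicator {p..<q} x) * f x * S x)"
    by (rule profile_integrable_mult[OF S _ bd(1)]) measurable
  have i2: "integrable lborel (\<lambda>x. indicator {p..<q} x * f x * S x)"
    by (rule profile_integrable_mult[OF S _ bd(2)]) measurable
  have i3: "integrable lborel (\<lambda>x. indicator {p..<q} x * f x)"
    by (rule integrable_bounded_support[OF _ bd(2), where a = p and b = q]) auto
  note i4 = profile_integrable_Ico[OF S, of p q]
  have "(\<integral>x. averaged p q f x * S x \<partial>lborel)
    = (\<integral>x. avg p q f * (indicator {p..<q} x * S x) + (1 - indicator {p..<q} x) * f x * S x \<partial>lborel)"
    by (intro Bochner_Integration.integral_cong) (auto simp: averaged_def indicator_def)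
  also have "\<dots> = avg p q f * (\<integral>x. indicator {p..<q} x * S x \<partial>lborel)
      + (\<integral>x. (1 - indicator {p..<q} x) * f x * S x \<partial>lborel)"
    using i1 i4 by simp
  finally show "(\<integral>x. averaged p q f x * S x \<partial>lborel)
      = avg p q f * avg p q S * (q - p) + (\<integral>x. (1 - indicator {p..<q} x) * f x * S x \<partial>lborel)"
    using pq by (simp add: avg_def)
  have "(\<integral>x. f x * averaged p q S x \<partial>lborel)
    = (\<integral>x. avg p q S * (indicator {p..<q} x * f x) + (1 - indicator {p..<q} x) * f x * S x \<partial>lborel)"
    by (intro Bochner_Integration.integral_cong) (auto simp: averaged_def indicator_def)
  also have "\<dots> = avg p q S * (\<integral>x. indicator {p..<q} x * f x \<partial>lborel)
      + (\<integral>x. (1 - indicator {p..<q} x) * f x * S x \<partial>lborel)"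
    using i1 i3 by simp
  finally show "(\<integral>x. f x * averaged p q S x \<partial>lborel)
      = avg p q f * avg p q S * (q - p) + (\<integral>x. (1 - indicator {p..<q} x) * f x * S x \<partial>lborel)"
    using pq by (simp add: avg_def)
  have "(\<integral>x. f x * S x \<partial>lborel)
    = (\<integral>x. indicator {p..<q} x * f x * S x + (1 - indicator {p..<q} x) * f x * S x \<partial>lborel)"
    by (intro Bochner_Integration.integral_cong) (auto simp: indicator_def)
  then show "(\<integral>x. f x * S x \<partial>lborel) = (\<integral>x. indicator {p..<q} x * (f x * S x) \<partial>lborel)
        + (\<integral>x. (1 - indicator {p..<q} x) * f x * S x \<partial>lborel)"
    using i1 i2 by (simp add: mult.assoc)
qed

text \<open>Chebyshev's sum inequality: \<open>f\<close> increases on \<open>{p..<q}\<close> while \<open>T\<close> decreases.\<close>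

lemma integral_pool_le:
  assumes T: "T \<in> profile" and f: "step_on P f" and pr: "0 \<le> p" "p < r" "r < q"
    and f1: "\<And>x. p \<le> x \<Longrightarrow> x < r \<Longrightarrow> f x = c1" and f2: "\<And>x. r \<le> x \<Longrightarrow> x < q \<Longrightarrow> f x = c2"
    and c: "c1 \<le> c2"
  shows "(\<integral>x. f x * T x \<partial>lborel) \<le> (\<integral>x. averaged p q f x * T x \<partial>lborel)"
proof -
  define A where "A = (\<integral>x. indicator {p..<r} x * T x \<partial>lborel)"
  define B where "B = (\<integral>x. indicator {r..<q} x * T x \<partial>lborel)"
  note i = profile_integrable_Ico[OF T]
  have "T r \<le> avg p r T" "avg r q T \<le> T r" using pr by (intro profile_avg_bounds[OF T]; simp)+
  then have "T r * (r - p) \<le> A" "B \<le> T r * (q - r)"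
    using pr by (simp_all add: A_def B_def avg_le_iff)
  then have "(r - p) * B \<le> (r - p) * (T r * (q - r))" "(q - r) * (T r * (r - p)) \<le> (q - r) * A"
    using pr by (intro mult_left_mono; simp)+
  then have "(r - p) * B \<le> (q - r) * A" by (simp add: algebra_simps)
  \<comment> \<open>This product is the difference of the two sides of the claim, multiplied by
    \<open>q - p\<close>.\<close>
  then have key: "0 \<le> (c2 - c1) * ((q - r) * A - (r - p) * B)" using c by simp
  have "(\<integral>x. indicator {p..<q} x * T x \<partial>lborel) = (\<integral>x. indicator {p..<r} x * T x + indicator {r..<q} x * T x \<partial>lborel)"
    using pr by (intro Bochner_Integration.integral_cong) (auto simp: indicator_def)
  then have T_int: "(\<integral>x. indicator {p..<q} x * T x \<partial>lborel) = A + B"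
    using i by (simp add: A_def B_def)
  have "(\<integral>x. indicator {p..<q} x * f x \<partial>lborel) = (\<integral>x. indicator {p..<r} x * c1 + indicator {r..<q} x * c2 \<partial>lborel)"
    using pr f1 f2 by (intro Bochner_Integration.integral_cong) (auto simp: indicator_def)
  also have "\<dots> = (r - p) * c1 + (q - r) * c2"
    using pr integrable_Ico by (subst Bochner_Integration.integral_add) auto
  finally have f_avg: "avg p q f = ((r - p) * c1 + (q - r) * c2) / (q - p)" by (simp add: avg_def)
  have "(\<integral>x. indicator {p..<q} x * (f x * T x) \<partial>lborel)
      = (\<integral>x. c1 * (indicator {p..<r} x * T x) + c2 * (indicator {r..<q} x * T x) \<partial>lborel)"
    using pr f1 f2 by (intro Bochner_Integration.integral_cong) (auto simp: indicator_def)
  also have "\<dots> = c1 * A + c2 * B" using i by (simp add: A_def B_def)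
  finally have fT: "(\<integral>x. indicator {p..<q} x * (f x * T x) \<partial>lborel) = c1 * A + c2 * B" .
  have "(c1 * A + c2 * B) * (q - p) \<le> ((r - p) * c1 + (q - r) * c2) * (A + B)"
    using key by (simp add: algebra_simps)
  then have "c1 * A + c2 * B \<le> avg p q f * (A + B)"
    using pr unfolding f_avg by (simp add: pos_le_divide_eq)
  also have "\<dots> = avg p q f * avg p q T * (q - p)"
    using pr by (simp add: avg_def[of p q T] T_int)
  finally have "c1 * A + c2 * B \<le> avg p q f * avg p q T * (q - p)" .
  moreover have "p < q" using pr by simp
  note split = integral_averaged_split[OF T f pr(1) this]
  ultimately show ?thesis
    unfolding split(1) split(3) fT by simp
qed

text \<open>Pooling deletes the breakpoint \<open>r\<close>, which makes the iteration terminate;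
  the new jumps occur at the ends, which are breakpoints already or the origin.\<close>

lemma averaged_step_on:
  assumes f: "step_on P f" and pr: "0 \<le> p" "p < r" "r < q" "p = 0 \<or> p \<in> P" "q \<in> P"
    and no: "P \<inter> {r<..<q} = {}"
  shows "step_on (P - {r}) (averaged p q f)"
proof -
  have [measurable]: "f \<in> borel_measurable borel" using f by (simp add: step_on_def)
  have avg0: "0 \<le> avg p q f"
    using f pr unfolding avg_def by (intro divide_nonneg_nonneg integral_nonneg) (auto simp: step_on_def)
  have "averaged p q f x = averaged p q f y"
    if xy: "0 \<le> x" "x \<le> y" "(P - {r}) \<inter> {x<..y} = {}" for x y
  proof -
    have *: "s \<notin> P \<or> s = r \<or> s \<le> x \<or> y < s" for s using xy(3) by (auto simp: disjoint_iff not_le not_less)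
    show ?thesis
    proof (cases "p \<le> x \<and> y < q")
      case True
      then show ?thesis using xy by (auto simp: averaged_def)
    next
      case False
      \<comment> \<open>A range \<open>{x<..y}\<close> that contains \<open>r\<close> but no other
        breakpoint would lie within \<open>{p..<q}\<close>, the case treated above.\<close>
      then have out: "\<not> (p \<le> x \<and> x < q)" "\<not> (p \<le> y \<and> y < q)" "\<not> (x < r \<and> r \<le> y)"
        using *[of p] *[of q] pr xy by auto
      have "f x = f y" using out(3) * by (intro step_on_const[OF f xy(1,2)]) (metis not_less)
      then show ?thesis by (simp only: averaged_def if_not_P[OF out(1)] if_not_P[OF out(2)])
    qed
  qed
  moreover have "averaged p q f \<in> borel_measurable borel" unfolding averaged_def by measurable
  moreover obtain L where "\<And>x. L \<le> x \<Longrightarrow> f x = 0" using f by (auto simp: step_on_def)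
  then have "\<forall>x\<ge>max L q. averaged p q f x = 0" by (auto simp: averaged_def)
  then have "\<exists>L. \<forall>x\<ge>L. averaged p q f x = 0" ..
  ultimately show ?thesis
    using f avg0 pr(1) unfolding step_on_def by (auto simp: averaged_def)
qed

context symmetric_gauge
begin

text \<open>Membership in the polar of the unit ball of \<open>N\<close>, tested on profiles. By
  passing to rearrangements it gives \<open>f_norm f T \<le> N T\<close> on all of
  \<open>J\<close>.\<close>

definition dual_feasible :: "(real \<Rightarrow> real) \<Rightarrow> bool" where
  "dual_feasible f \<longleftrightarrow> (\<forall>S\<in>profile. (\<integral>x. f x * S x \<partial>lborel) \<le> N (\<lambda>x. complex_of_real (S x)))"

text \<open>The bound survives a pooling step since the mean moves over to the test function by
  self-adjointness, where it yields a profile of no larger norm; the value at \<open>T\<close> does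
  not drop by Chebyshev's inequality.\<close>

lemma pool_adjacent_violators:
  assumes "step_on P f" "dual_feasible f" "T \<in> profile"
  obtains Q g where "step_on Q g" "dual_feasible g" "antimono_on {0..} g"
    "(\<integral>x. f x * T x \<partial>lborel) \<le> (\<integral>x. g x * T x \<partial>lborel)"
proof -
  have "\<exists>Q g. step_on Q g \<and> dual_feasible g \<and> antimono_on {0..} g \<and>
    (\<integral>x. f x * T x \<partial>lborel) \<le> (\<integral>x. g x * T x \<partial>lborel)"
    using assms
  proof (induction "card P" arbitrary: P f rule: less_induct)
    case less
    note f = less.prems(1)
    show ?case
    proof (cases "antimono_on {0..} f")
      case True
      then show ?thesis using less.prems by blast
    next
      case False
      obtain p r q where j: "0 \<le> p" "p < r" "r < q" "r \<in> P" "p = 0 \<or> p \<in> P" "q \<in> P"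
        "P \<inter> {p<..<r} = {}" "P \<inter> {r<..<q} = {}" "f p < f r"
        using step_on_upward_jump[OF f False] by blast
      let ?g = "averaged p q f"
      have "card (P - {r}) < card P"
        using j f by (intro psubset_card_mono) (auto simp: step_on_def)
      moreover have "step_on (P - {r}) ?g"
        using j by (intro averaged_step_on[OF f]) auto
      moreover have "dual_feasible ?g"
        unfolding dual_feasible_def
      proof
        fix S assume S: "S \<in> profile"
        have "(\<integral>x. ?g x * S x \<partial>lborel) = (\<integral>x. f x * averaged p q S x \<partial>lborel)"
          using j by (simp add: integral_averaged_split(1,2)[OF S f])
        also have "\<dots> \<le> N (\<lambda>x. complex_of_real (averaged p q S x))"
          using less.prems(2) averaged_profile[OF S, of p q] j by (auto simp: dual_feasible_def)
        also have "\<dots> \<le> N (\<lambda>x. complex_of_real (S x))"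
          using j by (intro N_averaged_le S) auto
        finally show "(\<integral>x. ?g x * S x \<partial>lborel) \<le> N (\<lambda>x. complex_of_real (S x))" .
      qed
      ultimately obtain Q g where g: "step_on Q g" "dual_feasible g" "antimono_on {0..} g"
        "(\<integral>x. ?g x * T x \<partial>lborel) \<le> (\<integral>x. g x * T x \<partial>lborel)"
        using less.hyps less.prems(3) by blast
      have "(\<integral>x. f x * T x \<partial>lborel) \<le> (\<integral>x. ?g x * T x \<partial>lborel)"
      proof (rule integral_pool_le[OF less.prems(3) f j(1-3), where ?c1.0 = "f p" and ?c2.0 = "f r"])
        show "f x = f p" if "p \<le> x" "x < r" for x
          using j(7) that by (intro step_on_const[OF f j(1), symmetric]) (auto simp: disjoint_iff)
        show "f x = f r" if "r \<le> x" "x < q" for x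
          using j that by (intro step_on_const[OF f, symmetric]) (auto simp: disjoint_iff)
      qed (use j in simp)
      then show ?thesis using g by (meson order_trans)
    qed
  qed
  then show thesis using that by blast
qed

end

section \<open>Supporting functionals and rearrangements\<close>

lemma nested_intervals_index:
  fixes b :: "nat \<Rightarrow> real"
  assumes "b k \<le> x" "x < b 0"
  obtains i where "i < k" "b (Suc i) \<le> x" "x < b i"
proof -
  have "\<exists>i<k. b (Suc i) \<le> x \<and> x < b i"
    using assms
  proof (induction k)
    case (Suc k)
    then show ?case by (cases "b k \<le> x") (auto simp: less_Suc_eq)
  qed simp
  then show thesis using that by blast
qed

context symmetric_gauge
begin

text \<open>
  The supporting functional is found on the span of the indicators of \<open>{b (Suc i)..<b i}\<close>;
  averaging over these intervals extends the bound to all profiles.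
\<close>

lemma supporting_step_function:
  fixes a b :: "nat \<Rightarrow> real"
  assumes b: "decseq b" "\<And>i. 0 \<le> b i" and a: "\<And>i. 0 \<le> a i"
  obtains P f where "step_on P f" "dual_feasible f"
    "\<And>S. S \<in> profile \<Longrightarrow> (\<And>i x. i < k \<Longrightarrow> b (Suc i) \<le> x \<Longrightarrow> x < b i \<Longrightarrow> a i \<le> S x) \<Longrightarrow>
      N (\<lambda>x. complex_of_real (\<Sum>i<k. a i * indicator {b (Suc i)..<b i} x)) \<le> (\<integral>x. f x * S x \<partial>lborel)"
proof -
  have bSuc: "b (Suc i) \<le> b i" for i using decseq_SucD[OF b(1)] .
  \<comment> \<open>With positive parts, \<open>p\<close> vanishes on vectors without positive
    entries. This forces the coefficients \<open>c i\<close>, and with them \<open>f\<close>, to be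
    nonnegative.\<close>
  define V where "V x t = (\<Sum>i<k. max (x i) 0 * indicator {b (Suc i)..<b i} t)" for x :: "nat \<Rightarrow> real" and t
  define p where "p x = N (\<lambda>t. complex_of_real (V x t))" for x
  have VJ: "(\<lambda>t. complex_of_real (V x t)) \<in> J" for x
    unfolding V_def using b(2) bSuc
    by (intro J_step) (auto simp: half_line_sets_iff emeasure_half_line_Ico intro: order_trans[OF b(2)])
  have V0: "0 \<le> V x t" for x t unfolding V_def by (intro sum_nonneg) auto
  have p: "sublinear p"
    unfolding sublinear_def
  proof (intro conjI allI impI)
    fix x y
    have "V (\<lambda>i. x i + y i) t \<le> V x t + V y t" for t
      unfolding V_def sum.distrib[symmetric] distrib_right[symmetric]
      by (intro sum_mono mult_right_mono) auto
    then have "p (\<lambda>i. x i + y i) \<le> N (\<lambda>t. complex_of_real (V x t + V y t))"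
      unfolding p_def using V0 J_add[OF VJ VJ, of x y] by (intro N_real_mono VJ) auto
    also have "\<dots> \<le> p x + p y" unfolding p_def using N_triangle[OF VJ VJ, of x y] by simp
    finally show "p (\<lambda>i. x i + y i) \<le> p x + p y" .
  next
    fix t :: real and x assume t: "0 \<le> t"
    have "V (\<lambda>i. t * x i) s = t * V x s" for s
      unfolding V_def sum_distrib_left using t
      by (intro sum.cong refl) (auto simp: max_def mult_le_0_iff zero_le_mult_iff)
    then show "p (\<lambda>i. t * x i) = t * p x"
      unfolding p_def using N_scale[OF VJ, of "complex_of_real t" x] t by simp
  qed
  define a' where "a' i = (if i < k then a i else 0)" for i
  obtain c where c: "\<And>x. (\<And>i. i \<ge> k \<Longrightarrow> x i = 0) \<Longrightarrow> (\<Sum>i<k. c i * x i) \<le> p x"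
    "p a' \<le> (\<Sum>i<k. c i * a' i)"
    using sublinear_supporting_functional[OF p, of k a'] by (auto simp: a'_def)
  have c_single: "c i * t \<le> p (\<lambda>j. if j = i then t else 0)" if "i < k" for i t
  proof -
    have "(\<Sum>j<k. c j * (if j = i then t else 0)) = (\<Sum>j<k. if j = i then c i * t else 0)"
      by (rule sum.cong) auto
    also have "\<dots> = c i * t" using that by simp
    finally show ?thesis using c(1)[of "\<lambda>j. if j = i then t else 0"] that by simp
  qed
  have c0: "0 \<le> c i" if "i < k" for i
  proof -
    have "V (\<lambda>j. if j = i then - 1 else 0) t = 0" for t
      unfolding V_def by (intro sum.neutral) auto
    then have "p (\<lambda>j. if j = i then - 1 else 0) = 0" by (simp add: p_def N_zero)
    then show ?thesis using c_single[OF that, of "- 1"] by simp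
  qed
  \<comment> \<open>Where \<open>b\<close> repeats a value the average is \<open>0\<close> by the
    convention for division and may lie below \<open>a i\<close>; the vanishing coefficient saves
    the comparison.\<close>
  have c_degenerate: "c i = 0" if "i < k" "b (Suc i) = b i" for i
  proof -
    have "V (\<lambda>j. if j = i then 1 else 0) t = 0" for t
      unfolding V_def using that by (intro sum.neutral) auto
    then have "p (\<lambda>j. if j = i then 1 else 0) = 0" by (simp add: p_def N_zero)
    then show ?thesis using c_single[OF that(1), of 1] c0[OF that(1)] by simp
  qed
  define f where "f t = (\<Sum>i<k. c i / (b i - b (Suc i)) * indicator {b (Suc i)..<b i} t)" for t
  have f_int: "(\<integral>x. f x * S x \<partial>lborel) = (\<Sum>i<k. c i * avg (b (Suc i)) (b i) S)" if S: "S \<in> profile" for S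
  proof -
    have "(\<integral>x. f x * S x \<partial>lborel)
      = (\<integral>x. (\<Sum>i<k. c i / (b i - b (Suc i)) * (indicator {b (Suc i)..<b i} x * S x)) \<partial>lborel)"
      unfolding f_def sum_distrib_right by (simp add: mult.assoc)
    also have "\<dots> = (\<Sum>i<k. c i / (b i - b (Suc i)) * (\<integral>x. indicator {b (Suc i)..<b i} x * S x \<partial>lborel))"
      using profile_integrable_Ico[OF S] by simp
    finally show ?thesis by (simp add: avg_def)
  qed
  have step: "step_on (b ` {..k}) f"
    unfolding step_on_def
  proof (intro conjI allI impI)
    show "f \<in> borel_measurable borel" unfolding f_def by measurable
    show "f x = 0" if "x < 0" for x
      unfolding f_def
    proof (intro sum.neutral ballI)
      fix i show "c i / (b i - b (Suc i)) * indicator {b (Suc i)..<b i} x = 0"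
        using that b(2)[of "Suc i"] by (simp add: indicator_def)
    qed
    show "0 \<le> f x" for x
      unfolding f_def using c0 bSuc by (intro sum_nonneg) auto
    show "f x = f y" if "0 \<le> x" "x \<le> y" "b ` {..k} \<inter> {x<..y} = {}" for x y
      unfolding f_def
    proof (intro sum.cong refl arg_cong2[where f = "(*)"])
      fix i assume "i \<in> {..<k}"
      then have "b i \<in> b ` {..k}" "b (Suc i) \<in> b ` {..k}" by auto
      then have "b i \<notin> {x<..y}" "b (Suc i) \<notin> {x<..y}" using that(3) by blast+
      then show "indicator {b (Suc i)..<b i} x = (indicator {b (Suc i)..<b i} y :: real)"
        using that(2) by (auto simp: indicator_def)
    qed
    have "f x = 0" if "b 0 \<le> x" for x
      unfolding f_def
    proof (intro sum.neutral ballI)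
      fix i
      have "b i \<le> x" using decseqD[OF b(1), of 0 i] that by simp
      then show "c i / (b i - b (Suc i)) * indicator {b (Suc i)..<b i} x = 0" by simp
    qed
    then show "\<exists>L. \<forall>x\<ge>L. f x = 0" by blast
  qed simp
  have "dual_feasible f"
    unfolding dual_feasible_def
  proof
    fix S assume S: "S \<in> profile"
    define s where "s i = (if i < k then avg (b (Suc i)) (b i) S else 0)" for i
    \<comment> \<open>The intervals run from right to left. Left of \<open>b n\<close> nothing has
      changed yet, so the next mean taken of \<open>U\<close> is the mean of
      \<open>S\<close>.\<close>
    have "\<exists>U\<in>profile. N (\<lambda>x. complex_of_real (U x)) \<le> N (\<lambda>x. complex_of_real (S x)) \<and>
        (\<forall>x<b n. U x = S x) \<and>
        (\<forall>i<n. \<forall>x. b (Suc i) \<le> x \<longrightarrow> x < b i \<longrightarrow> U x = avg (b (Suc i)) (b i) S)" for n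
    proof (induction n)
      case 0
      then show ?case using S by blast
    next
      case (Suc n)
      then obtain U where U: "U \<in> profile" "N (\<lambda>x. complex_of_real (U x)) \<le> N (\<lambda>x. complex_of_real (S x))"
        "\<And>x. x < b n \<Longrightarrow> U x = S x"
        "\<And>i x. i < n \<Longrightarrow> b (Suc i) \<le> x \<Longrightarrow> x < b i \<Longrightarrow> U x = avg (b (Suc i)) (b i) S"
        by blast
      show ?case
      proof (cases "b (Suc n) < b n")
        case True
        let ?U = "averaged (b (Suc n)) (b n) U"
        have "avg (b (Suc n)) (b n) U = avg (b (Suc n)) (b n) S"
          unfolding avg_def using U(3)
          by (intro arg_cong2[where f = "(/)"] Bochner_Integration.integral_cong refl) (auto simp: indicator_def)
        then have "?U x = avg (b (Suc i)) (b i) S" if "i < Suc n" "b (Suc i) \<le> x" "x < b i" for i x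
        proof (cases "i = n")
          case False
          then have "i < n" using that(1) by simp
          moreover from this have "b n \<le> x" using decseqD[OF b(1), of "Suc i" n] that(2) by simp
          ultimately show ?thesis using U(4)[of i x] that by (simp add: averaged_def)
        qed (use that in \<open>simp add: averaged_def\<close>)
        moreover have "?U x = S x" if "x < b (Suc n)" for x
          using that True U(3)[of x] by (simp add: averaged_def)
        ultimately show ?thesis
          using averaged_profile[OF U(1) b(2) True] N_averaged_le[OF U(1) b(2) True] U(2)
          by (intro bexI[of _ ?U]) auto
      next
        case False
        then have "b (Suc n) = b n" using bSuc[of n] by simp
        then show ?thesis using U by (intro bexI[of _ U]) (auto simp: less_Suc_eq)
      qed
    qed
    from this[of k] obtain U where U: "U \<in> profile" "N (\<lambda>x. complex_of_real (U x)) \<le> N (\<lambda>x. complex_of_real (S x))"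
      "\<And>i x. i < k \<Longrightarrow> b (Suc i) \<le> x \<Longrightarrow> x < b i \<Longrightarrow> U x = avg (b (Suc i)) (b i) S"
      by blast
    have s0: "0 \<le> s i" for i
      unfolding s_def avg_def using bSuc profile_nonneg[OF S]
      by (auto intro!: divide_nonneg_nonneg integral_nonneg)
    have "V s x \<le> U x" for x
    proof (cases "b k \<le> x \<and> x < b 0")
      case True
      then obtain i where i: "i < k" "b (Suc i) \<le> x" "x < b i"
        using nested_intervals_index[of b k x] by blast
      have "V s x = (\<Sum>j<k. if j = i then s i else 0)"
        unfolding V_def
      proof (intro sum.cong refl)
        fix j
        have "j = i" if "b (Suc j) \<le> x" "x < b j"
        proof (rule ccontr)
          assume "j \<noteq> i"
          then have "Suc j \<le> i \<or> Suc i \<le> j" by linarith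
          then have "b i \<le> b (Suc j) \<or> b j \<le> b (Suc i)" using decseqD[OF b(1)] by blast
          then show False using that i by linarith
        qed
        then show "max (s j) 0 * indicator {b (Suc j)..<b j} x = (if j = i then s i else 0)"
          using i(2,3) s0[of i] by (cases "b (Suc j) \<le> x \<and> x < b j") (auto simp: indicator_def)
      qed
      also have "\<dots> = U x" using i U(3)[OF i] by (simp add: s_def)
      finally show ?thesis by simp
    next
      case False
      have "V s x = 0"
        unfolding V_def
      proof (intro sum.neutral ballI)
        fix i assume "i \<in> {..<k}"
        then have "b k \<le> b (Suc i)" "b i \<le> b 0" using decseqD[OF b(1)] by auto
        then show "max (s i) 0 * indicator {b (Suc i)..<b i} x = 0"
          using False by (auto simp: indicator_def)
      qed
      then show ?thesis using profile_nonneg[OF U(1)] by simp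
    qed
    then have "p s \<le> N (\<lambda>x. complex_of_real (U x))"
      unfolding p_def using V0 by (intro N_real_mono VJ profile_J U) auto
    moreover have "(\<integral>x. f x * S x \<partial>lborel) \<le> p s"
      using c(1)[of s] by (simp add: f_int[OF S] s_def)
    ultimately show "(\<integral>x. f x * S x \<partial>lborel) \<le> N (\<lambda>x. complex_of_real (S x))" using U(2) by linarith
  qed
  moreover have "N (\<lambda>x. complex_of_real (\<Sum>i<k. a i * indicator {b (Suc i)..<b i} x)) \<le> (\<integral>x. f x * S x \<partial>lborel)"
    if S: "S \<in> profile" and le: "\<And>i x. i < k \<Longrightarrow> b (Suc i) \<le> x \<Longrightarrow> x < b i \<Longrightarrow> a i \<le> S x" for S
  proof -
    have "V a' = (\<lambda>t. \<Sum>i<k. a i * indicator {b (Suc i)..<b i} t)"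
      using a by (auto simp: V_def a'_def fun_eq_iff intro!: sum.cong)
    then have "N (\<lambda>x. complex_of_real (\<Sum>i<k. a i * indicator {b (Suc i)..<b i} x)) = p a'"
      by (simp only: p_def)
    also have "\<dots> \<le> (\<Sum>i<k. c i * a' i)" by (rule c(2))
    also have "\<dots> \<le> (\<Sum>i<k. c i * avg (b (Suc i)) (b i) S)"
    proof (intro sum_mono)
      fix i assume "i \<in> {..<k}"
      then have i: "i < k" by simp
      show "c i * a' i \<le> c i * avg (b (Suc i)) (b i) S"
      proof (cases "b (Suc i) = b i")
        case True
        then show ?thesis using c_degenerate[OF i] by simp
      next
        case False
        then have lt: "b (Suc i) < b i" using bSuc[of i] by simp
        have "(\<integral>x. indicator {b (Suc i)..<b i} x * a i \<partial>lborel) \<le> (\<integral>x. indicator {b (Suc i)..<b i} x * S x \<partial>lborel)"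
          using le[OF i] by (intro integral_mono integrable_Ico profile_integrable_Ico[OF S]) (auto simp: indicator_def)
        then have "a i \<le> avg (b (Suc i)) (b i) S"
          using lt by (simp add: avg_le_iff mult.commute)
        then show ?thesis using c0[OF i] i by (intro mult_left_mono) (auto simp: a'_def)
      qed
    qed
    also have "\<dots> = (\<integral>x. f x * S x \<partial>lborel)" by (simp add: f_int[OF S])
    finally show ?thesis .
  qed
  ultimately show thesis using step that by blast
qed

end

text \<open>For negative \<open>s\<close> the cast \<open>ennreal s\<close> is \<open>0\<close>, so
  \<open>mu s T\<close> would repeat \<open>mu 0 T\<close>; the cut-off makes the function a
  profile.\<close>

definition rearranged :: "(real \<Rightarrow> complex) \<Rightarrow> real \<Rightarrow> real" where
  "rearranged T s = (if s < 0 then 0 else mu s T)"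

section \<open>Distribution function and nonincreasing rearrangement\<close>

context
  fixes T :: "real \<Rightarrow> complex" and D :: "real \<Rightarrow> real"
  assumes T: "T \<in> J"
  defines "D y \<equiv> measure half_line {x. 0 \<le> x \<and> y < cmod (T x)}"
begin

lemma distribution_emeasure: "0 \<le> y \<Longrightarrow> emeasure half_line {x. 0 \<le> x \<and> y < cmod (T x)} = ennreal (D y)"
  unfolding D_def using J_level_set(2)[OF T, of y] by (intro emeasure_eq_ennreal_measure) auto

lemma distribution_antimono: "0 \<le> y \<Longrightarrow> y \<le> z \<Longrightarrow> D z \<le> D y"
  unfolding D_def using J_level_set[OF T]
  by (intro measure_mono_fmeasurable) (auto simp: fmeasurable_def)

lemma distribution_right: "0 \<le> y \<Longrightarrow> (\<lambda>n. D (y + 1 / real (Suc n))) \<longlonglongrightarrow> D y"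
proof -
  assume y: "0 \<le> y"
  have U: "(\<Union>n. {x. 0 \<le> x \<and> y + 1 / real (Suc n) < cmod (T x)}) = {x. 0 \<le> x \<and> y < cmod (T x)}"
  proof safe
    fix x n assume "y + 1 / real (Suc n) < cmod (T x)"
    moreover have "0 < 1 / real (Suc n)" by simp
    ultimately show "y < cmod (T x)" by linarith
  next
    fix x :: real assume "y < cmod (T x)" "0 \<le> x"
    then obtain n where "1 / real (Suc n) < cmod (T x) - y"
      using reals_Archimedean[of "cmod (T x) - y"] by (auto simp: inverse_eq_divide)
    then have "y + 1 / real (Suc n) < cmod (T x)" by linarith
    then show "x \<in> (\<Union>n. {x. 0 \<le> x \<and> y + 1 / real (Suc n) < cmod (T x)})" using \<open>0 \<le> x\<close> by blast
  qed
  have "(\<lambda>n. measure half_line {x. 0 \<le> x \<and> y + 1 / real (Suc n) < cmod (T x)})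
      \<longlonglongrightarrow> measure half_line (\<Union>n. {x. 0 \<le> x \<and> y + 1 / real (Suc n) < cmod (T x)})"
  proof (rule Lim_measure_incseq)
    show "range (\<lambda>n. {x. 0 \<le> x \<and> y + 1 / real (Suc n) < cmod (T x)}) \<subseteq> sets half_line"
      using y by (intro image_subsetI J_level_set[OF T]) simp
    show "incseq (\<lambda>n. {x. 0 \<le> x \<and> y + 1 / real (Suc n) < cmod (T x)})"
    proof (rule incseq_SucI, safe)
      fix n x assume "y + 1 / real (Suc n) < cmod (T x)"
      moreover have "1 / real (Suc (Suc n)) \<le> 1 / real (Suc n)" by (intro divide_left_mono) auto
      ultimately show "y + 1 / real (Suc (Suc n)) < cmod (T x)" by linarith
    qed
    show "emeasure half_line (\<Union>n. {x. 0 \<le> x \<and> y + 1 / real (Suc n) < cmod (T x)}) \<noteq> \<infinity>"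
      unfolding U using J_level_set(2)[OF T y] by simp
  qed
  then show ?thesis unfolding U D_def .
qed

lemma distribution_vanishes: obtains C where "\<And>y. C \<le> y \<Longrightarrow> 0 \<le> y \<Longrightarrow> D y = 0"
proof -
  obtain C where C: "AE x in half_line. cmod (T x) \<le> C" using T by (auto simp: J_def Linf_def)
  have "D y = 0" if "C \<le> y" "0 \<le> y" for y
  proof -
    have "AE x in half_line. x \<notin> {x. 0 \<le> x \<and> y < cmod (T x)}"
      using C by eventually_elim (use that in auto)
    then have "emeasure half_line {x. 0 \<le> x \<and> y < cmod (T x)} = 0"
      using J_level_set(1)[OF T that(2)] by (subst AE_iff_measurable[symmetric]) auto
    then show ?thesis by (simp add: D_def measure_def)
  qed
  then show thesis by (rule that)
qed

lemma mu_set_eq: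
  assumes "0 \<le> s"
  shows "mu s T = Sup ({0} \<union> {y. 0 \<le> y \<and> s < D y})"
proof -
  have "{x \<in> {0..}. y < cmod (T x)} = {x. 0 \<le> x \<and> y < cmod (T x)}" for y by auto
  then have "{y. 0 \<le> y \<and> emeasure half_line {x \<in> {0..}. y < cmod (T x)} > ennreal s} = {y. 0 \<le> y \<and> s < D y}"
    using distribution_emeasure assms by (auto simp: ennreal_less_iff)
  then show ?thesis by (simp only: mu_def)
qed

lemma mu_set_bdd:
  assumes "0 \<le> s"
  shows "bdd_above ({0} \<union> {y. 0 \<le> y \<and> s < D y})"
proof -
  obtain C where C: "\<And>y. C \<le> y \<Longrightarrow> 0 \<le> y \<Longrightarrow> D y = 0" using distribution_vanishes by blast
  then have "y \<le> max 0 C" if "0 \<le> y" "s < D y" for y using that assms by (cases "C \<le> y") force+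
  then show ?thesis by (intro bdd_aboveI[of _ "max 0 C"]) auto
qed

text \<open>Rearrangement and distribution function are inverse to each other in this sense. Right
  continuity of \<open>D\<close> keeps the inequality strict: if \<open>s < D y\<close>, the same
  holds slightly above \<open>y\<close>.\<close>

lemma less_mu_iff:
  assumes s: "0 \<le> s" and y: "0 \<le> y"
  shows "y < mu s T \<longleftrightarrow> s < D y"
proof
  assume "y < mu s T"
  then obtain z where z: "z \<in> {0} \<union> {y. 0 \<le> y \<and> s < D y}" "y < z"
    unfolding mu_set_eq[OF s] using less_cSup_iff[OF _ mu_set_bdd[OF s]] by auto
  then show "s < D y" using distribution_antimono[OF y, of z] y by auto
next
  assume "s < D y"
  then have "eventually (\<lambda>n. s < D (y + 1 / real (Suc n))) sequentially"
    by (rule order_tendstoD[OF distribution_right[OF y]])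
  then obtain n where "s < D (y + 1 / real (Suc n))" by (auto simp: eventually_sequentially)
  then have "y + 1 / real (Suc n) \<le> mu s T"
    unfolding mu_set_eq[OF s] using y by (intro cSup_upper mu_set_bdd[OF s]) auto
  moreover have "0 < 1 / real (Suc n)" by simp
  ultimately show "y < mu s T" by linarith
qed

lemma mu_nonneg: "0 \<le> s \<Longrightarrow> 0 \<le> mu s T"
  using mu_set_bdd by (subst mu_set_eq) (auto intro: cSup_upper)

lemma rearranged_profile: "rearranged T \<in> profile"
proof -
  have "mu t T \<le> mu s T" if "0 \<le> s" "s \<le> t" for s t
  proof (rule ccontr)
    assume *: "\<not> ?thesis"
    then have "t < D (mu s T)" using that less_mu_iff[of t "mu s T"] mu_nonneg[of s] by simp
    then have "mu s T < mu s T" using that less_mu_iff[of s "mu s T"] mu_nonneg[of s] by simp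
    then show False by simp
  qed
  moreover have "rearranged T s = 0" if "max 0 (D 0) \<le> s" for s
    using that less_mu_iff[of s 0] mu_nonneg[of s] by (auto simp: rearranged_def)
  then have "\<exists>L. \<forall>s\<ge>L. rearranged T s = 0" by blast
  ultimately show ?thesis
    using mu_nonneg unfolding profile_def by (auto simp: rearranged_def monotone_on_def)
qed

lemma rearranged_level:
  assumes "0 \<le> y"
  shows "{x. 0 \<le> x \<and> y < cmod (complex_of_real (rearranged T x))} = {0..<D y}"
proof (rule set_eqI)
  fix x
  show "x \<in> {x. 0 \<le> x \<and> y < cmod (complex_of_real (rearranged T x))} \<longleftrightarrow> x \<in> {0..<D y}"
    using less_mu_iff[of x y] mu_nonneg[of x] assms by (cases "0 \<le> x") (auto simp: rearranged_def)
qed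

lemma rearranged_distribution:
  assumes "0 \<le> y"
  shows "measure half_line {x. 0 \<le> x \<and> y < cmod (complex_of_real (rearranged T x))} = D y"
  unfolding rearranged_level[OF assms] by (simp add: D_def)

text \<open>Both factors are Borel, so the integral for the completed measure is one for
  \<open>lborel\<close>.\<close>

lemma f_norm_rearranged:
  assumes f: "step_on P f"
  shows "f_norm f T = (\<integral>x. f x * rearranged T x \<partial>lborel)"
proof -
  have [measurable]: "f \<in> borel_measurable borel" "rearranged T \<in> borel_measurable borel"
    using f profile_measurable[OF rearranged_profile] by (auto simp: step_on_def)
  have "f_norm f T = (\<integral>x. f x * rearranged T x \<partial>lebesgue)"
    unfolding f_norm_def set_lebesgue_integral_def
    by (intro Bochner_Integration.integral_cong refl) (auto simp: rearranged_def indicator_def)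
  also have "\<dots> = (\<integral>x. f x * rearranged T x \<partial>lborel)"
    by (rule integral_completion) measurable
  finally show ?thesis .
qed

end

lemma (in symmetric_gauge) N_rearranged:
  assumes T: "T \<in> J"
  shows "N (\<lambda>x. complex_of_real (rearranged T x)) = N T"
  by (intro antisym N_le_of_distribution_le profile_J rearranged_profile T)
    (simp_all only: rearranged_distribution[OF T] order_refl)

text \<open>Slicing by height: on \<open>{b (Suc i)..<b i}\<close> the rearrangement lies between
  \<open>i * \<epsilon>\<close> and \<open>(i + 1) * \<epsilon>\<close>. The lower value is what the
  supporting functional is compared with; the upper one shows that the step function misses
  \<open>N T\<close> by at most \<epsilon> times the norm of a fixed indicator.\<close>

lemma (in symmetric_gauge) exists_dual_feasible:
  assumes T: "T \<in> J" and \<delta>: "0 < \<delta>"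
  obtains Q g where "step_on Q g" "dual_feasible g" "antimono_on {0..} g"
    "N T \<le> (\<integral>x. g x * rearranged T x \<partial>lborel) + \<delta>"
proof -
  define D where "D y = measure half_line {x. 0 \<le> x \<and> y < cmod (T x)}" for y
  define S where "S = rearranged T"
  have S: "S \<in> profile" unfolding S_def by (rule rearranged_profile[OF T])
  have less_iff: "y < S x \<longleftrightarrow> x < D y" if "0 \<le> x" "0 \<le> y" for x y
    using less_mu_iff[OF T that] that by (simp add: S_def rearranged_def D_def)
  let ?X = "\<lambda>x. complex_of_real (indicator {0..<D 0} x)"
  have X: "?X \<in> J" by (intro J_indicator) (auto simp: half_line_sets_iff D_def)
  \<comment> \<open>The summand 1 covers the case that the indicator has norm zero.\<close>
  define \<epsilon> where "\<epsilon> = \<delta> / (N ?X + 1)"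
  have NX: "0 \<le> N ?X" by (rule N_nonneg[OF X])
  have \<epsilon>: "0 < \<epsilon>" "\<epsilon> * N ?X \<le> \<delta>" using NX \<delta> by (auto simp: \<epsilon>_def divide_simps)
  obtain C where C: "\<And>y. C \<le> y \<Longrightarrow> 0 \<le> y \<Longrightarrow> D y = 0"
    unfolding D_def using distribution_vanishes[OF T] by blast
  \<comment> \<open>The top height is beyond the essential bound, hence \<open>b k = 0\<close> and
    the intervals reach down to the origin.\<close>
  obtain k :: nat where "C / \<epsilon> \<le> real k" using real_arch_simple by blast
  then have k: "C \<le> real k * \<epsilon>" using \<epsilon> by (simp add: divide_simps)
  define b where "b i = D (real i * \<epsilon>)" for i :: nat
  have b: "decseq b"
    unfolding b_def D_def using \<epsilon>
    by (intro decseq_SucI distribution_antimono[OF T]) (auto intro!: mult_right_mono)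
  have b0: "0 \<le> b i" for i by (simp add: b_def D_def)
  have bk: "b k = 0" unfolding b_def using \<epsilon> by (intro C k) simp
  let ?V = "\<lambda>x. \<Sum>i<k. real i * \<epsilon> * indicator {b (Suc i)..<b i} x"
  have a: "0 \<le> real i * \<epsilon>" for i using \<epsilon>(1) by simp
  obtain P f where f: "step_on P f" "dual_feasible f"
    "\<And>S. S \<in> profile \<Longrightarrow> (\<And>i x. i < k \<Longrightarrow> b (Suc i) \<le> x \<Longrightarrow> x < b i \<Longrightarrow> real i * \<epsilon> \<le> S x) \<Longrightarrow>
      N (\<lambda>x. complex_of_real (?V x)) \<le> (\<integral>x. f x * S x \<partial>lborel)"
    by (rule supporting_step_function[where a = "\<lambda>i. real i * \<epsilon>" and k = k, OF b b0 a]) blast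
  obtain Q g where g: "step_on Q g" "dual_feasible g" "antimono_on {0..} g"
    "(\<integral>x. f x * S x \<partial>lborel) \<le> (\<integral>x. g x * S x \<partial>lborel)"
    using pool_adjacent_violators[OF f(1,2) S] by blast
  have VJ: "(\<lambda>x. complex_of_real (?V x)) \<in> J"
    using b0 decseq_SucD[OF b]
    by (intro J_step) (auto simp: half_line_sets_iff emeasure_half_line_Ico intro: order_trans[OF b0])
  have VX: "(\<lambda>x. complex_of_real (?V x + \<epsilon> * indicator {0..<D 0} x)) \<in> J"
    using J_add[OF VJ J_scale[OF X, of "complex_of_real \<epsilon>"]] by simp
  have le: "S x \<le> ?V x + \<epsilon> * indicator {0..<D 0} x" if "0 \<le> x" for x
  proof (cases "x < D 0")
    case True
    then have "b k \<le> x" "x < b 0" using that bk by (simp_all add: b_def)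
    then obtain i where i: "i < k" "b (Suc i) \<le> x" "x < b i"
      by (rule nested_intervals_index)
    have "S x \<le> real (Suc i) * \<epsilon>"
      using less_iff[OF that, of "real (Suc i) * \<epsilon>"] i(2) \<epsilon> by (simp add: b_def not_less)
    moreover have "real i * \<epsilon> * indicator {b (Suc i)..<b i} x \<le> ?V x"
      using i(1) \<epsilon> by (intro member_le_sum) auto
    ultimately show ?thesis using i True that by (simp add: distrib_right)
  next
    case False
    then have "S x \<le> 0" using less_iff[OF that, of 0] by simp
    moreover have "0 \<le> ?V x" using \<epsilon> by (intro sum_nonneg) auto
    ultimately show ?thesis using False by simp
  qed
  have "N T = N (\<lambda>x. complex_of_real (S x))" unfolding S_def by (rule N_rearranged[OF T, symmetric])
  also have "\<dots> \<le> N (\<lambda>x. complex_of_real (?V x + \<epsilon> * indicator {0..<D 0} x))"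
    using profile_nonneg[OF S] le by (intro N_real_mono profile_J S VX) auto
  also have "\<dots> \<le> N (\<lambda>x. complex_of_real (?V x)) + \<epsilon> * N ?X"
    using N_triangle[OF VJ J_scale[OF X, of "complex_of_real \<epsilon>"]] N_scale[OF X, of "complex_of_real \<epsilon>"] \<epsilon>
    by simp
  also have "N (\<lambda>x. complex_of_real (?V x)) \<le> (\<integral>x. f x * S x \<partial>lborel)"
  proof (rule f(3)[OF S])
    fix i x assume i: "i < k" "b (Suc i) \<le> x" "x < b i"
    then show "real i * \<epsilon> \<le> S x"
      using less_iff[of x "real i * \<epsilon>"] b0[of "Suc i"] \<epsilon> by (simp add: b_def)
  qed
  finally have "N T \<le> (\<integral>x. g x * S x \<partial>lborel) + \<delta>" using g(4) \<epsilon>(2) by linarith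
  then show thesis using that g by (simp add: S_def)
qed

section \<open>Membership in the class of step functions and the final supremum\<close>

lemma indicator_unit_profile: "indicator {0..<1} \<in> profile"
  unfolding profile_def by (auto simp: indicator_def monotone_on_def intro!: exI[of _ 1])

lemma step_on_indicator_unit: "step_on {1} (indicator {0..<1})"
  unfolding step_on_def by (auto simp: indicator_def intro!: exI[of _ 1])

text \<open>Testing the dual bound on the indicator of \<open>{0..<1}\<close>, which has norm 1,
  gives the integral condition; right continuity comes from the half-open convention for
  breakpoints.\<close>

lemma (in symmetric_gauge) dual_feasible_F_class:
  assumes f: "step_on P f" and dual: "dual_feasible f" and mono: "antimono_on {0..} f"
    and norm: "N (\<lambda>x. complex_of_real (indicator {0..<1} x)) = 1"
  shows "f \<in> F_class"
proof -
  have [measurable]: "f \<in> borel_measurable borel" using f by (simp add: step_on_def)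
  have "simple_function half_line f"
    by (intro simple_function_borel_measurable borel_measurable_half_lineI step_on_finite_range[OF f])
      measurable
  moreover have "compact (closure {x. f x \<noteq> 0})"
  proof -
    obtain L where "\<And>x. L \<le> x \<Longrightarrow> f x = 0" "\<And>x. x < 0 \<Longrightarrow> f x = 0" using f by (auto simp: step_on_def)
    then have "{x. f x \<noteq> 0} \<subseteq> {0..L}" by (force simp: not_le[symmetric])
    then have "bounded {x. f x \<noteq> 0}" by (rule bounded_subset[OF bounded_closed_interval])
    then show ?thesis by simp
  qed
  moreover have "continuous (at_right x) f" if "0 \<le> x" for x
  proof -
    define z where "z = Min (insert (x + 1) (P \<inter> {x<..}))"
    have fin: "finite (insert (x + 1) (P \<inter> {x<..}))" using f by (simp add: step_on_def)
    have "x < z" unfolding z_def using fin by (subst Min_gr_iff) auto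
    moreover have "f y = f x" if "x < y" "y < z" for y
    proof (rule step_on_const[OF f, symmetric])
      fix r assume "r \<in> P" "x < r" "r \<le> y"
      then show False using Min_le[OF fin, of r] that by (simp add: z_def)
    qed (use that \<open>0 \<le> x\<close> in auto)
    ultimately have "eventually (\<lambda>y. f y = f x) (at_right x)"
      unfolding eventually_at_right_field by blast
    then show ?thesis unfolding continuous_within by (rule tendsto_eventually)
  qed
  moreover have "(LINT x:{0..1}|lebesgue. f x) \<le> 1"
  proof -
    have "(LINT x:{0..1}|lebesgue. f x) = (\<integral>x. indicator {0..1} x * f x \<partial>lborel)"
      unfolding set_lebesgue_integral_def real_scaleR_def by (rule integral_completion) measurable
    also have "\<dots> = (\<integral>x. f x * indicator {0..<1} x \<partial>lborel)"
    proof (rule integral_cong_AE)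
      show "AE x in lborel. indicator {0..1} x * f x = f x * indicator {0..<1} x"
        using AE_lborel_singleton[of "1::real"] by eventually_elim (auto simp: indicator_def)
    qed measurable
    also have "\<dots> \<le> 1"
      using dual indicator_unit_profile norm by (auto simp: dual_feasible_def)
    finally show ?thesis .
  qed
  ultimately show ?thesis using f mono by (simp add: F_class_def step_on_def)
qed

text \<open>The integral is the mean \<open>m\<close> of \<open>S\<close> over the unit interval. It
  equals the norm of \<open>m\<close> times the indicator, and this function lies below
  \<open>S\<close> averaged there.\<close>

lemma (in symmetric_gauge) dual_feasible_indicator_unit:
  assumes norm: "N (\<lambda>x. complex_of_real (indicator {0..<1} x)) = 1"
  shows "dual_feasible (indicator {0..<1})"
  unfolding dual_feasible_def
proof
  fix S assume S: "S \<in> profile"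
  let ?X = "\<lambda>x. complex_of_real (indicator {0..<1} x)"
  have X: "?X \<in> J" by (rule profile_J[OF indicator_unit_profile])
  have U: "averaged 0 1 S \<in> profile" by (rule averaged_profile[OF S]) auto
  define m where "m = avg 0 1 S"
  have m: "0 \<le> m" using profile_avg_bounds[OF S, of 0 1] profile_nonneg[OF S, of 1] by (simp add: m_def)
  have mX: "(\<lambda>x. complex_of_real (m * indicator {0..<1} x)) \<in> J"
    using J_scale[OF X, of "complex_of_real m"] by simp
  have "(\<integral>x. indicator {0..<1} x * S x \<partial>lborel) = m" by (simp add: m_def avg_def)
  also have "m = N (\<lambda>x. complex_of_real (m * indicator {0..<1} x))"
    using N_scale[OF X, of "complex_of_real m"] norm m by simp
  also have "\<dots> \<le> N (\<lambda>x. complex_of_real (averaged 0 1 S x))"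
    using m profile_nonneg[OF S]
    by (intro N_real_mono mX profile_J U) (auto simp: averaged_def m_def indicator_def)
  also have "\<dots> \<le> N (\<lambda>x. complex_of_real (S x))" by (rule N_averaged_le[OF S]) auto
  finally show "(\<integral>x. indicator {0..<1} x * S x \<partial>lborel) \<le> N (\<lambda>x. complex_of_real (S x))" .
qed

theorem corollary7p2:
  fixes N :: "(real \<Rightarrow> complex) \<Rightarrow> real"
  assumes "symmetric_gauge_norm N" and "normalized N"
  shows "\<exists>F' \<subseteq> F_class. indicator {0..<1} \<in> F' \<and>
           (\<forall>T\<in>J. ereal (N T) = (SUP f\<in>F'. ereal (f_norm f T)))"
proof -
  interpret symmetric_gauge N by standard (rule assms(1))
  \<comment> \<open>\<open>normalized\<close> speaks of the complex-valued indicator, the lemmas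
    above of the real one cast to \<open>complex\<close>.\<close>
  have "(\<lambda>x. complex_of_real (indicator {0..<1} x)) = indicator {0..<1}"
    by (auto simp: indicator_def)
  moreover have "{0..<1::real} \<in> sets half_line" "emeasure half_line {0..<1} = 1"
    by (auto simp: half_line_sets_iff emeasure_half_line_Ico)
  ultimately have norm: "N (\<lambda>x. complex_of_real (indicator {0..<1} x)) = 1"
    using assms(2) unfolding normalized_def by metis
  \<comment> \<open>The largest admissible family: the supremum is at most \<open>N T\<close> by
    definition, and only members that nearly attain it are to be found.\<close>
  define F' where "F' = {f \<in> F_class. \<forall>T\<in>J. f_norm f T \<le> N T}"
  have F'I: "f \<in> F'" if "step_on P f" "dual_feasible f" "antimono_on {0..} f" for P f
  proof -
    have "f_norm f T \<le> N T" if T: "T \<in> J" for T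
      using f_norm_rearranged[OF T \<open>step_on P f\<close>] \<open>dual_feasible f\<close> rearranged_profile[OF T] N_rearranged[OF T]
      by (auto simp: dual_feasible_def)
    then show ?thesis using dual_feasible_F_class[OF that norm] by (simp add: F'_def)
  qed
  have "indicator {0..<1} \<in> F'"
    using dual_feasible_indicator_unit[OF norm] indicator_unit_profile
    by (intro F'I[OF step_on_indicator_unit]) (auto simp: profile_def)
  moreover have "ereal (N T) = (SUP f\<in>F'. ereal (f_norm f T))" if T: "T \<in> J" for T
  proof (rule antisym)
    show "(SUP f\<in>F'. ereal (f_norm f T)) \<le> ereal (N T)"
      using T by (intro SUP_least) (auto simp: F'_def)
    show "ereal (N T) \<le> (SUP f\<in>F'. ereal (f_norm f T))"
    proof (rule ereal_le_epsilon2)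
      fix \<delta> :: real assume "0 < \<delta>"
      then obtain Q g where g: "step_on Q g" "dual_feasible g" "antimono_on {0..} g"
        "N T \<le> (\<integral>x. g x * rearranged T x \<partial>lborel) + \<delta>"
        using exists_dual_feasible[OF T] by blast
      then have "ereal (N T) \<le> ereal (f_norm g T) + ereal \<delta>"
        using f_norm_rearranged[OF T g(1)] by simp
      also have "\<dots> \<le> (SUP f\<in>F'. ereal (f_norm f T)) + ereal \<delta>"
        using F'I[OF g(1-3)] by (intro add_right_mono SUP_upper)
      finally show "ereal (N T) \<le> (SUP f\<in>F'. ereal (f_norm f T)) + ereal \<delta>" .
    qed
  qed
  moreover have "F' \<subseteq> F_class" by (auto simp: F'_def)
  ultimately show ?thesis by blast
qed

end
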